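(* For every $\varepsilon>0$, there is a $(1+\varepsilon)$-approximate Turing kernelization for \textsc{Capacitated Dominating Set} parameterized by $\mathrm{tw}+\Delta$ whose oracle queries are capacitated graphs with $\mathcal{O}(\frac{1+\varepsilon}{\varepsilon}\cdot\mathrm{tw}\cdot\Delta^2)$ vertices.
   Context: \textsc{Capacitated Dominating Set}: given a capacitated graph $(V,E,\mathrm{cap})$ with $\mathrm{cap}\colon V\to\mathbb{N}$, find a pair $(X,f)$ with $X\subseteq V$, $f\colon V\setminus X\to X$, $v$ adjacent to $f(v)$ for all $v\in V\setminus X$, and $\lvert f^{-1}(v)\rvert\le\mathrm{cap}(v)$ for $v\in X$, minimizing $\lvert X\rvert$. $\mathrm{tw}$ is the treewidth and $\Delta$ the maximum degree of the input graph. The algorithm receives the graph together with a nice tree decomposition of width $\mathrm{tw}(G)$ (rooted, root and leaf bags empty, every other node a forget, introduce, or join node). A $(1+\varepsilon)$-approximate Turing kernelization is a polynomial-time algorithm that, with access to an oracle returning in a single step a $c$-approximate solution for any instance of bounded size (here: with the stated number of vertices), outputs a $c(1+\varepsilon)$-approximate solution for the input, without knowing or depending on $c$. *)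

theory Defs
  imports Complex_Main "HOL-Computational_Algebra.Polynomial"
begin

section \<open>Finite simple graphs and trees\<close>

record 'a graph =
  verts :: "'a set"
  edges :: "'a set set"

definition simple_graph :: "('a, 'b) graph_scheme \<Rightarrow> bool" where
  "simple_graph G \<longleftrightarrow> finite (verts G) \<and> (\<forall>e\<in>edges G. e \<subseteq> verts G \<and> card e = 2)"

definition walk :: "('a, 'b) graph_scheme \<Rightarrow> 'a list \<Rightarrow> bool" where
  "walk G xs \<longleftrightarrow> xs \<noteq> [] \<and> set xs \<subseteq> verts G \<and> successively (\<lambda>u v. {u, v} \<in> edges G) xs"

definition connected_graph :: "('a, 'b) graph_scheme \<Rightarrow> bool" where
  "connected_graph G \<longleftrightarrow>
     (\<forall>u\<in>verts G. \<forall>v\<in>verts G. \<exists>xs. walk G xs \<and> hd xs = u \<and> last xs = v)"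

definition cycle :: "('a, 'b) graph_scheme \<Rightarrow> 'a list \<Rightarrow> bool" where
  "cycle G xs \<longleftrightarrow> walk G xs \<and> distinct xs \<and> 3 \<le> length xs \<and> {last xs, hd xs} \<in> edges G"

definition tree_graph :: "('a, 'b) graph_scheme \<Rightarrow> bool" where
  "tree_graph G \<longleftrightarrow> simple_graph G \<and> verts G \<noteq> {} \<and> connected_graph G \<and> (\<nexists>xs. cycle G xs)"

definition induced :: "('a, 'b) graph_scheme \<Rightarrow> 'a set \<Rightarrow> 'a graph" where
  "induced G S = \<lparr>verts = verts G \<inter> S, edges = {e \<in> edges G. e \<subseteq> S}\<rparr>"

definition degree_of :: "('a, 'b) graph_scheme \<Rightarrow> 'a \<Rightarrow> nat" where
  "degree_of G v = card {u. {v, u} \<in> edges G}"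

definition max_degree :: "('a, 'b) graph_scheme \<Rightarrow> nat" where
  "max_degree G = Max (insert 0 (degree_of G ` verts G))"


section \<open>Tree decompositions and treewidth\<close>

definition tree_decomposition ::
  "('v, 'b) graph_scheme \<Rightarrow> 't graph \<Rightarrow> ('t \<Rightarrow> 'v set) \<Rightarrow> bool" where
  "tree_decomposition G T bag \<longleftrightarrow>
     tree_graph T \<and>
     (\<Union>t\<in>verts T. bag t) = verts G \<and>
     (\<forall>e\<in>edges G. \<exists>t\<in>verts T. e \<subseteq> bag t) \<and>
     (\<forall>v\<in>verts G. connected_graph (induced T {t. v \<in> bag t}))"

text \<open>The subtraction is truncated, so the empty graph has treewidth \<open>0\<close>.\<close>

definition width :: "'t graph \<Rightarrow> ('t \<Rightarrow> 'v set) \<Rightarrow> nat" where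
  "width T bag = Max ((\<lambda>t. card (bag t)) ` verts T) - 1"

definition treewidth :: "('v, 'b) graph_scheme \<Rightarrow> nat" where
  "treewidth G =
     (LEAST k. \<exists>(T :: nat graph) bag. tree_decomposition G T bag \<and> width T bag = k)"

text \<open>
  Rooted tree decompositions are finite rooted trees whose nodes are labelled by their bags.
  A node is addressed by the list of child indices leading to it from the root; the addresses
  are the vertices of the underlying tree.
\<close>

datatype 'a rtree = Node (label: 'a) (children: "'a rtree list")

fun is_pos :: "'a rtree \<Rightarrow> nat list \<Rightarrow> bool" where
  "is_pos t [] = True"
| "is_pos t (i # p) = (i < length (children t) \<and> is_pos (children t ! i) p)"

fun subtree :: "'a rtree \<Rightarrow> nat list \<Rightarrow> 'a rtree" where
  "subtree t [] = t"
| "subtree t (i # p) = subtree (children t ! i) p"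

definition graph_of :: "'a rtree \<Rightarrow> nat list graph" where
  "graph_of t = \<lparr>verts = {p. is_pos t p}, edges = {{p, p @ [i]} | p i. is_pos t (p @ [i])}\<rparr>"

definition bag_at :: "'v set rtree \<Rightarrow> nat list \<Rightarrow> 'v set" where
  "bag_at t p = label (subtree t p)"

definition rwidth :: "'v set rtree \<Rightarrow> nat" where
  "rwidth t = width (graph_of t) (bag_at t)"

definition introduce_node :: "'v set rtree \<Rightarrow> bool" where
  "introduce_node t \<longleftrightarrow> (\<exists>c v. children t = [c] \<and> v \<notin> label c \<and> label t = insert v (label c))"

definition forget_node :: "'v set rtree \<Rightarrow> bool" where
  "forget_node t \<longleftrightarrow> (\<exists>c v. children t = [c] \<and> v \<in> label c \<and> label t = label c - {v})"

definition join_node :: "'v set rtree \<Rightarrow> bool" where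
  "join_node t \<longleftrightarrow> (\<exists>c d. children t = [c, d] \<and> label c = label t \<and> label d = label t)"

text \<open>
  Every node other than the root and the leaves is an introduce, forget or join node. The root
  only has to have an empty bag, so the usual definition, in which the root (if it is not a
  leaf) has one of the three types as well, is a special case.
\<close>

definition nice :: "'v set rtree \<Rightarrow> bool" where
  "nice t \<longleftrightarrow>
     label t = {} \<and>
     (\<forall>p. is_pos t p \<and> children (subtree t p) = [] \<longrightarrow> bag_at t p = {}) \<and>
     (\<forall>p. is_pos t p \<and> p \<noteq> [] \<and> children (subtree t p) \<noteq> [] \<longrightarrow>
        introduce_node (subtree t p) \<or> forget_node (subtree t p) \<or> join_node (subtree t p))"

definition nice_tree_decomposition :: "('v, 'b) graph_scheme \<Rightarrow> 'v set rtree \<Rightarrow> bool" where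
  "nice_tree_decomposition G t \<longleftrightarrow> tree_decomposition G (graph_of t) (bag_at t) \<and> nice t"


section \<open>Capacitated dominating sets\<close>

record 'a cgraph = "'a graph" +
  cap :: "'a \<Rightarrow> nat"

definition cap_dom_set :: "'a cgraph \<Rightarrow> 'a set \<Rightarrow> ('a \<Rightarrow> 'a) \<Rightarrow> bool" where
  "cap_dom_set G X f \<longleftrightarrow>
     X \<subseteq> verts G \<and>
     (\<forall>v \<in> verts G - X. f v \<in> X \<and> {v, f v} \<in> edges G) \<and>
     (\<forall>x\<in>X. card {v \<in> verts G - X. f v = x} \<le> cap G x)"

definition cds_opt :: "'a cgraph \<Rightarrow> nat" where
  "cds_opt G = (LEAST k. \<exists>X f. cap_dom_set G X f \<and> card X = k)"

definition approx_cds :: "real \<Rightarrow> 'a cgraph \<Rightarrow> 'a set \<Rightarrow> ('a \<Rightarrow> 'a) \<Rightarrow> bool" where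
  "approx_cds c G X f \<longleftrightarrow> cap_dom_set G X f \<and> real (card X) \<le> c * real (cds_opt G)"


section \<open>Machine model\<close>

text \<open>
  The model is the WHILE language of N. D. Jones (Computability and Complexity from a
  Programming Perspective), extended by a conditional and a command that queries an oracle.
  Data are binary trees without labels, and the only operations are pairing, the two
  projections and the test for \<open>Nl\<close>. Values can be stored with sharing, so that each of these
  operations takes constant time, and the functions with outputs of polynomial size that are
  computed in polynomially many steps are the polynomial-time computable ones.
\<close>

datatype dtree = Nl | Pr dtree dtree

fun left :: "dtree \<Rightarrow> dtree" where
  "left Nl = Nl"
| "left (Pr a b) = a"

fun right :: "dtree \<Rightarrow> dtree" where
  "right Nl = Nl"
| "right (Pr a b) = b"

datatype expr = Var nat | ENl | EPr expr expr | ELeft expr | ERight expr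

type_synonym store = "nat \<Rightarrow> dtree"

fun val :: "expr \<Rightarrow> store \<Rightarrow> dtree" where
  "val (Var x) s = s x"
| "val ENl s = Nl"
| "val (EPr a b) s = Pr (val a s) (val b s)"
| "val (ELeft a) s = left (val a s)"
| "val (ERight a) s = right (val a s)"

datatype com =
    Assign nat expr
  | Query nat expr
  | Seq com com
  | Cond expr com com
  | While expr com

text \<open>
  \<open>exec ora P s s' n Q\<close>: with oracle \<open>ora\<close>, started in store \<open>s\<close>, program \<open>P\<close> terminates in
  store \<open>s'\<close> after \<open>n\<close> steps, and \<open>Q\<close> is the set of queries made. Each assignment, test and
  query counts as one step; this is accurate up to a constant factor, as the expressions
  occurring in a program have fixed size.
\<close>

inductive exec :: "(dtree \<Rightarrow> dtree) \<Rightarrow> com \<Rightarrow> store \<Rightarrow> store \<Rightarrow> nat \<Rightarrow> dtree set \<Rightarrow> bool"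
  for ora :: "dtree \<Rightarrow> dtree" where
  Assign: "exec ora (Assign x e) s (s(x := val e s)) 1 {}"
| Query: "exec ora (Query x e) s (s(x := ora (val e s))) 1 {val e s}"
| Seq: "exec ora P s s' m Q \<Longrightarrow> exec ora P' s' s'' n Q' \<Longrightarrow>
    exec ora (Seq P P') s s'' (m + n) (Q \<union> Q')"
| CondTrue: "val e s \<noteq> Nl \<Longrightarrow> exec ora P s s' n Q \<Longrightarrow> exec ora (Cond e P P') s s' (n + 1) Q"
| CondFalse: "val e s = Nl \<Longrightarrow> exec ora P' s s' n Q \<Longrightarrow> exec ora (Cond e P P') s s' (n + 1) Q"
| WhileFalse: "val e s = Nl \<Longrightarrow> exec ora (While e P) s s 1 {}"
| WhileTrue: "val e s \<noteq> Nl \<Longrightarrow> exec ora P s s' m Q \<Longrightarrow> exec ora (While e P) s' s'' n Q' \<Longrightarrow>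
    exec ora (While e P) s s'' (m + n + 1) (Q \<union> Q')"

text \<open>The input is passed in variable \<open>0\<close>, which also holds the output on termination.\<close>

definition init :: "dtree \<Rightarrow> store" where
  "init d = (\<lambda>_. Nl)(0 := d)"


section \<open>Encodings\<close>

text \<open>Numbers are encoded in binary, least significant bit first, without leading zeros.\<close>

fun bits :: "nat \<Rightarrow> bool list" where
  "bits n = (if n = 0 then [] else odd n # bits (n div 2))"

declare bits.simps [simp del]

fun enc_bool :: "bool \<Rightarrow> dtree" where
  "enc_bool False = Nl"
| "enc_bool True = Pr Nl Nl"

fun enc_list :: "dtree list \<Rightarrow> dtree" where
  "enc_list [] = Nl"
| "enc_list (d # ds) = Pr d (enc_list ds)"

definition enc_nat :: "nat \<Rightarrow> dtree" where
  "enc_nat n = enc_list (map enc_bool (bits n))"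

definition enc_nat_pair :: "nat \<times> nat \<Rightarrow> dtree" where
  "enc_nat_pair p = Pr (enc_nat (fst p)) (enc_nat (snd p))"

text \<open>Sets are listed in arbitrary order without repetitions, and edges in either orientation.\<close>

definition encodes_cgraph :: "dtree \<Rightarrow> nat cgraph \<Rightarrow> bool" where
  "encodes_cgraph d G \<longleftrightarrow>
     (\<exists>vs es. distinct vs \<and> set vs = verts G \<and>
        distinct (map (\<lambda>(u, v). {u, v}) es) \<and> set (map (\<lambda>(u, v). {u, v}) es) = edges G \<and>
        d = Pr (enc_list (map (\<lambda>v. enc_nat_pair (v, cap G v)) vs)) (enc_list (map enc_nat_pair es)))"

fun enc_rtree :: "nat list rtree \<Rightarrow> dtree" where
  "enc_rtree (Node b ts) = Pr (enc_list (map enc_nat b)) (enc_list (map enc_rtree ts))"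

definition encodes_rtree :: "dtree \<Rightarrow> nat set rtree \<Rightarrow> bool" where
  "encodes_rtree d T \<longleftrightarrow>
     (\<exists>t. map_rtree set t = T \<and> (\<forall>b\<in>set_rtree t. distinct b) \<and> d = enc_rtree t)"

text \<open>A solution \<open>(X, f)\<close> is given by a list of \<open>X\<close> and the graph of \<open>f\<close> on the other vertices.\<close>

definition encodes_solution :: "dtree \<Rightarrow> nat cgraph \<Rightarrow> nat set \<Rightarrow> (nat \<Rightarrow> nat) \<Rightarrow> bool" where
  "encodes_solution d G X f \<longleftrightarrow>
     (\<exists>xs ys. distinct xs \<and> set xs = X \<and> distinct ys \<and> set ys = verts G - X \<and>
        d = Pr (enc_list (map enc_nat xs)) (enc_list (map (\<lambda>v. enc_nat_pair (v, f v)) ys)))"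


section \<open>Approximate Turing kernelizations\<close>

definition approx_answer :: "real \<Rightarrow> nat cgraph \<Rightarrow> dtree \<Rightarrow> bool" where
  "approx_answer c G d \<longleftrightarrow> (\<exists>X f. encodes_solution d G X f \<and> approx_cds c G X f)"

definition approx_oracle :: "real \<Rightarrow> real \<Rightarrow> (dtree \<Rightarrow> dtree) \<Rightarrow> bool" where
  "approx_oracle c b ora \<longleftrightarrow>
     (\<forall>H q. simple_graph H \<and> real (card (verts H)) \<le> b \<and> encodes_cgraph q H \<longrightarrow>
        approx_answer c H (ora q))"

text \<open>
  \<open>approx_turing_kernelization r param b\<close>: Capacitated Dominating Set, parameterized by
  \<open>param\<close>, has an \<open>r\<close>-approximate Turing kernelization that on input \<open>G\<close> only queries
  capacitated graphs with at most \<open>b G\<close> vertices, where \<open>b G\<close> is bounded in terms of the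
  parameter. The input consists of \<open>G\<close> and a nice tree decomposition of \<open>G\<close> of minimum width.
  The program and the polynomial bounding its running time do not depend on \<open>c\<close>. Size counts
  the pairs in the input.
\<close>

definition approx_turing_kernelization ::
  "real \<Rightarrow> (nat cgraph \<Rightarrow> nat) \<Rightarrow> (nat cgraph \<Rightarrow> real) \<Rightarrow> bool" where
  "approx_turing_kernelization r param b \<longleftrightarrow>
     (\<exists>h :: nat \<Rightarrow> nat. \<forall>G. simple_graph G \<longrightarrow> b G \<le> real (h (param G))) \<and>
     (\<exists>P (p :: nat poly).
        \<forall>G T dG dT (c :: real) ora.
          simple_graph G \<and> nice_tree_decomposition G T \<and> rwidth T = treewidth G \<and>
          encodes_cgraph dG G \<and> encodes_rtree dT T \<and> c \<ge> 1 \<and> approx_oracle c (b G) ora \<longrightarrow>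
          (\<exists>s n Q.
             exec ora P (init (Pr dG dT)) s n Q \<and>
             n \<le> poly p (size (Pr dG dT)) \<and>
             (\<forall>q\<in>Q. \<exists>H. simple_graph H \<and> real (card (verts H)) \<le> b G \<and> encodes_cgraph q H) \<and>
             approx_answer (c * r) G (s 0)))"

end

theory Submission
  imports Defs "HOL-Library.While_Combinator"
begin

text \<open>
  Let \<open>k = \<lceil>1/\<epsilon>\<rceil>\<close> and let \<open>\<Delta>\<close> be the maximum degree. Walk through the rooted tree decomposition
  bottom-up and assign every vertex to the topmost node whose bag contains it. Whenever the
  vertices collected below a node with bag \<open>b\<close> number more than \<open>k |b| (\<Delta> + 1)\<^sup>2\<close>, cut them off as a
  piece. Edges that leave a piece for a later one end in the bag \<open>b\<close>, and pieces have
  \<open>O(k tw \<Delta>\<^sup>2)\<close> vertices. The union of solutions of the subgraphs induced by the pieces is a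
  solution of \<open>G\<close>. Conversely, restrict an optimal solution of \<open>G\<close> to the pieces and add the vertices
  that are dominated across pieces: these lie in the closed neighbourhoods of the bags used for
  cutting, so there are at most \<open>\<Sum> |b| (\<Delta> + 1) \<le> |V| / (k (\<Delta> + 1))\<close> of them, which is at most \<open>opt / k\<close>
  because a vertex dominates at most \<open>\<Delta> + 1\<close> vertices. Graphs without edges need no query.
\<close>

section \<open>Polynomial-time functions on binary trees\<close>

text \<open>The pieces, and hence all queries, are fixed before the first answer arrives. This
  splits the algorithm: everything up to the list of queries is one oracle-free function, shown
  polynomial by closure properties of the WHILE language, and a single explicit loop then asks the
  queries and concatenates the answers. The closure properties have to control sizes as well as
  steps, since pairing a value with itself doubles it in one step. Numbers that are only compared
  with lengths are kept in unary, which avoids binary arithmetic.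

  The square in the cut-off pays for two losses of a factor \<Delta> + 1: one in passing from the
  cutting bags to their closed neighbourhoods, the other in comparing |V| with the optimum. The
  cut-off is tested after each child, not once per node, so a piece never collects more than one
  child's share on top of an amount below the cut-off. The root is handled as the child of a virtual
  node with empty bag: the cut-off there is 0, so nothing is left over.\<close>

definition pbounded :: "(dtree \<Rightarrow> nat) \<Rightarrow> bool" where
  "pbounded T \<longleftrightarrow> (\<exists>e. \<forall>d. T d \<le> (size d + 2) ^ e)"

lemma pbounded_mono: "pbounded T' \<Longrightarrow> (\<And>d. T d \<le> T' d) \<Longrightarrow> pbounded T"
  unfolding pbounded_def by (meson order_trans)

text \<open>The base \<open>size d + 2\<close> is at least 2, so \<open>c\<close> is below
  \<open>2 ^ c\<close>. Constants and coefficients thus disappear into the exponent, and single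
  powers can stand for all polynomial bounds.\<close>

lemma pbounded_const: "pbounded (\<lambda>d. c)"
  unfolding pbounded_def
proof (intro exI allI)
  fix d :: dtree
  have "c \<le> 2 ^ c" using less_exp[of c] by linarith
  also have "\<dots> \<le> (size d + 2) ^ c" by (rule power_mono) auto
  finally show "c \<le> (size d + 2) ^ c" .
qed

lemma pbounded_size: "pbounded size"
  unfolding pbounded_def by (intro exI[of _ 1]) simp

lemma pbounded_mult:
  assumes "pbounded S" "pbounded T" shows "pbounded (\<lambda>d. S d * T d)"
proof -
  obtain a b where "\<forall>d. S d \<le> (size d + 2) ^ a" "\<forall>d. T d \<le> (size d + 2) ^ b"
    using assms unfolding pbounded_def by blast
  then have "\<forall>d. S d * T d \<le> (size d + 2) ^ (a + b)"
    by (simp add: power_add mult_mono)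
  then show ?thesis unfolding pbounded_def by blast
qed

text \<open>Sums reduce to products, where exponents simply add, through a + b \<le> 2 (a + 1) (b +
  1).\<close>

lemma pbounded_add:
  assumes "pbounded S" "pbounded T" shows "pbounded (\<lambda>d. S d + T d)"
proof -
  have "pbounded (\<lambda>d. 2 * ((S d + 1) * (T d + 1)))"
  proof -
    have suc: "pbounded (\<lambda>d. U d + 1)" if "pbounded U" for U
    proof -
      obtain a where a: "\<forall>d. U d \<le> (size d + 2) ^ a"
        using \<open>pbounded U\<close> unfolding pbounded_def by blast
      have "U d + 1 \<le> (size d + 2) ^ Suc a" for d
      proof -
        have "1 \<le> (size d + 2) ^ a" by simp
        then have "U d + 1 \<le> 2 * (size d + 2) ^ a" using a[rule_format, of d] by linarith
        also have "\<dots> \<le> (size d + 2) * (size d + 2) ^ a" by (rule mult_right_mono) auto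
        finally show ?thesis by simp
      qed
      then show ?thesis unfolding pbounded_def by blast
    qed
    show ?thesis by (intro pbounded_const pbounded_mult suc assms)
  qed
  then show ?thesis by (rule pbounded_mono) (simp add: algebra_simps)
qed

lemma pbounded_Suc: "pbounded T \<Longrightarrow> pbounded (\<lambda>d. Suc (T d))"
  using pbounded_add[OF _ pbounded_const[of 1]] by simp

lemma pbounded_power: "pbounded T \<Longrightarrow> pbounded (\<lambda>d. T d ^ e)"
  by (induction e) (simp_all add: pbounded_const[of 1, simplified] pbounded_mult)

lemmas pbounded_intros = pbounded_const pbounded_size pbounded_mult pbounded_add pbounded_Suc
  pbounded_power

lemma pbounded_comp:
  assumes "pbounded T" "pbounded (\<lambda>d. size (f d))" shows "pbounded (\<lambda>d. T (f d))"
proof -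
  obtain e where e: "\<forall>d. T d \<le> (size d + 2) ^ e"
    using assms unfolding pbounded_def by blast
  have "pbounded (\<lambda>d. (size (f d) + 2) ^ e)" by (intro pbounded_intros assms)
  then show ?thesis by (rule pbounded_mono) (rule e[rule_format])
qed

text \<open>
  Programs are parametrized by a register \<open>m\<close>, which passes the argument and the result.
  They may overwrite all registers above \<open>m\<close> and preserve those below, so that a caller can keep
  its own data in lower registers.
\<close>

definition implements :: "(nat \<Rightarrow> com) \<Rightarrow> (dtree \<Rightarrow> dtree) \<Rightarrow> (dtree \<Rightarrow> nat) \<Rightarrow> bool" where
  "implements P f T \<longleftrightarrow> (\<forall>ora m s. \<exists>s' n.
     exec ora (P m) s s' n {} \<and> s' m = f (s m) \<and> (\<forall>y<m. s' y = s y) \<and> n \<le> T (s m))"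

text \<open>The size bound does not follow from the time bound: n assignments can build a tree with
  2^n leaves by sharing. Composition needs it, because the second program runs in time polynomial in
  the output of the first.\<close>

definition ptime :: "(dtree \<Rightarrow> dtree) \<Rightarrow> bool" where
  "ptime f \<longleftrightarrow> (\<exists>P T. implements P f T \<and> pbounded T) \<and> pbounded (\<lambda>d. size (f d))"

lemma implementsE:
  assumes "implements P f T"
  obtains s' n where "exec ora (P m) s s' n {}" "s' m = f (s m)" "\<And>y. y < m \<Longrightarrow> s' y = s y"
    "n \<le> T (s m)"
  using assms unfolding implements_def by metis

lemma exec_Assign: "val e s = d \<Longrightarrow> exec ora (Assign x e) s (s(x := d)) 1 {}"
  using exec.Assign by blast

lemma exec_Seq: "exec ora P s s' m {} \<Longrightarrow> exec ora P' s' s'' n {} \<Longrightarrow>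
    exec ora (Seq P P') s s'' (m + n) {}"
  using exec.Seq[of ora P s s' m "{}" P' s'' n "{}"] by simp

lemma ptimeI:
  assumes "pbounded T" "pbounded (\<lambda>d. size (f d))"
    and "\<And>ora m s. \<exists>s' n. exec ora (P m) s s' n {} \<and> s' m = f (s m) \<and>
           (\<forall>y<m. s' y = s y) \<and> n \<le> T (s m)"
  shows "ptime f"
  using assms unfolding ptime_def implements_def by blast

lemma ptimeE:
  assumes "ptime f"
  obtains P T where "implements P f T" "pbounded T" "pbounded (\<lambda>d. size (f d))"
  using assms unfolding ptime_def by blast

lemma ptime_assign:
  assumes "\<And>m s. val (E m) s = f (s m)" "pbounded (\<lambda>d. size (f d))"
  shows "ptime f"
proof (rule ptimeI[where T = "\<lambda>_. 1" and P = "\<lambda>m. Assign m (E m)"])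
  fix ora and m :: nat and s :: store
  show "\<exists>s' n. exec ora (Assign m (E m)) s s' n {} \<and> s' m = f (s m) \<and>
           (\<forall>y<m. s' y = s y) \<and> n \<le> 1"
    using exec.Assign[of ora m "E m" s] assms(1)[of m s] by (auto intro!: exI)
qed (intro pbounded_intros assms)+

lemma ptime_id: "ptime (\<lambda>d. d)"
  by (rule ptime_assign[where E = Var]) (auto intro: pbounded_intros)

lemma size_left_right: "size (left d) \<le> size d" "size (right d) \<le> size d"
  by (cases d; simp)+

lemma ptime_comp:
  assumes "ptime g" "ptime f"
  shows "ptime (\<lambda>d. g (f d))"
proof -
  obtain P T where f: "implements P f T" "pbounded T" "pbounded (\<lambda>d. size (f d))"
    using ptimeE[OF assms(2)] .
  obtain P' T' where g: "implements P' g T'" "pbounded T'" "pbounded (\<lambda>d. size (g d))"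
    using ptimeE[OF assms(1)] .
  show ?thesis
  proof (rule ptimeI[where T = "\<lambda>d. T d + T' (f d)" and P = "\<lambda>m. Seq (P m) (P' m)"])
    show "pbounded (\<lambda>d. T d + T' (f d))" by (intro pbounded_intros f pbounded_comp[OF g(2)])
    show "pbounded (\<lambda>d. size (g (f d)))" by (rule pbounded_comp[OF g(3) f(3)])
    fix ora and m :: nat and s :: store
    obtain s1 n1 where 1: "exec ora (P m) s s1 n1 {}" "s1 m = f (s m)"
        "\<And>y. y < m \<Longrightarrow> s1 y = s y" "n1 \<le> T (s m)"
      using implementsE[OF f(1)] by metis
    obtain s2 n2 where 2: "exec ora (P' m) s1 s2 n2 {}" "s2 m = g (s1 m)"
        "\<And>y. y < m \<Longrightarrow> s2 y = s1 y" "n2 \<le> T' (s1 m)"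
      using implementsE[OF g(1)] by metis
    show "\<exists>s' n. exec ora (Seq (P m) (P' m)) s s' n {} \<and> s' m = g (f (s m)) \<and>
           (\<forall>y<m. s' y = s y) \<and> n \<le> T (s m) + T' (f (s m))"
      using exec_Seq[OF 1(1) 2(1)] 1 2 by (metis add_mono)
  qed
qed

lemma ptime_left: "ptime f \<Longrightarrow> ptime (\<lambda>d. left (f d))"
proof (rule ptime_comp[of left])
  show "ptime left"
    by (rule ptime_assign[where E = "\<lambda>m. ELeft (Var m)"])
      (auto intro: pbounded_mono[OF pbounded_size] size_left_right)
qed

lemma ptime_right: "ptime f \<Longrightarrow> ptime (\<lambda>d. right (f d))"
proof (rule ptime_comp[of right])
  show "ptime right"
    by (rule ptime_assign[where E = "\<lambda>m. ERight (Var m)"])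
      (auto intro: pbounded_mono[OF pbounded_size] size_left_right)
qed

lemma ptime_Pr:
  assumes "ptime f" "ptime g"
  shows "ptime (\<lambda>d. Pr (f d) (g d))"
proof -
  obtain P T where f: "implements P f T" "pbounded T" "pbounded (\<lambda>d. size (f d))"
    using ptimeE[OF assms(1)] .
  obtain P' T' where g: "implements P' g T'" "pbounded T'" "pbounded (\<lambda>d. size (g d))"
    using ptimeE[OF assms(2)] .
  \<comment> \<open>The argument stays in register \<open>m\<close> until the end, and the second
    program starts at \<open>m+2\<close> so that the first result survives in
    \<open>m+1\<close>.\<close>
  let ?P = "\<lambda>m. Seq (Assign (m+1) (Var m)) (Seq (P (m+1)) (Seq (Assign (m+2) (Var m))
     (Seq (P' (m+2)) (Assign m (EPr (Var (m+1)) (Var (m+2)))))))"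
  show ?thesis
  proof (rule ptimeI[where T = "\<lambda>d. T d + T' d + 3" and P = ?P])
    show "pbounded (\<lambda>d. T d + T' d + 3)" by (intro pbounded_intros f g)
    show "pbounded (\<lambda>d. size (Pr (f d) (g d)))" by (auto intro!: pbounded_intros f g)
    fix ora and m :: nat and s :: store
    let ?s = "s(m+1 := s m)"
    obtain s1 n1 where 1: "exec ora (P (m+1)) ?s s1 n1 {}" "s1 (m+1) = f (s m)"
        "\<And>y. y < m+1 \<Longrightarrow> s1 y = ?s y" "n1 \<le> T (s m)"
      using implementsE[OF f(1), of ora "m+1" ?s] by auto
    let ?s1 = "s1(m+2 := s1 m)"
    obtain s2 n2 where 2: "exec ora (P' (m+2)) ?s1 s2 n2 {}" "s2 (m+2) = g (s1 m)"
        "\<And>y. y < m+2 \<Longrightarrow> s2 y = ?s1 y" "n2 \<le> T' (s1 m)"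
      using implementsE[OF g(1), of ora "m+2" ?s1] by auto
    have s1m: "s1 m = s m" using 1(3)[of m] by simp
    let ?s' = "s2(m := Pr (s2 (m+1)) (s2 (m+2)))"
    have "exec ora (?P m) s ?s' (1 + (n1 + (1 + (n2 + 1)))) {}"
      by (rule exec_Seq[OF exec_Assign exec_Seq[OF 1(1) exec_Seq[OF exec_Assign
            exec_Seq[OF 2(1) exec_Assign]]]]) simp_all
    moreover have "?s' m = Pr (f (s m)) (g (s m))"
      using 1 2 s1m 2(3)[of "m+1"] by auto
    moreover have "\<forall>y<m. ?s' y = s y" using 1 2 by simp
    moreover have "1 + (n1 + (1 + (n2 + 1))) \<le> T (s m) + T' (s m) + 3" using 1 2 s1m by simp
    ultimately show "\<exists>s' n. exec ora (?P m) s s' n {} \<and> s' m = Pr (f (s m)) (g (s m)) \<and>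
           (\<forall>y<m. s' y = s y) \<and> n \<le> T (s m) + T' (s m) + 3" by blast
  qed
qed

lemma ptime_const: "ptime (\<lambda>d. c)"
proof (induction c)
  case Nl
  show ?case by (rule ptime_assign[where E = "\<lambda>_. ENl"]) (auto intro: pbounded_intros)
qed (rule ptime_Pr)

lemma ptime_if:
  assumes "ptime c" "ptime f" "ptime g"
  shows "ptime (\<lambda>d. if c d = Nl then f d else g d)"
proof -
  obtain P0 T0 where c: "implements P0 c T0" "pbounded T0" "pbounded (\<lambda>d. size (c d))"
    using ptimeE[OF assms(1)] .
  obtain P T where f: "implements P f T" "pbounded T" "pbounded (\<lambda>d. size (f d))"
    using ptimeE[OF assms(2)] .
  obtain P' T' where g: "implements P' g T'" "pbounded T'" "pbounded (\<lambda>d. size (g d))"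
    using ptimeE[OF assms(3)] .
  let ?P = "\<lambda>m. Seq (Assign (m+1) (Var m)) (Seq (P0 (m+1)) (Cond (Var (m+1)) (P' m) (P m)))"
  show ?thesis
  proof (rule ptimeI[where T = "\<lambda>d. T0 d + T d + T' d + 2" and P = ?P])
    show "pbounded (\<lambda>d. T0 d + T d + T' d + 2)" by (intro pbounded_intros c f g)
    have "pbounded (\<lambda>d. size (f d) + size (g d))" by (intro pbounded_intros f g)
    then show "pbounded (\<lambda>d. size (if c d = Nl then f d else g d))"
      by (rule pbounded_mono) auto
    fix ora and m :: nat and s :: store
    let ?s = "s(m+1 := s m)"
    obtain s1 n1 where 1: "exec ora (P0 (m+1)) ?s s1 n1 {}" "s1 (m+1) = c (s m)"
        "\<And>y. y < m+1 \<Longrightarrow> s1 y = ?s y" "n1 \<le> T0 (s m)"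
      using implementsE[OF c(1), of ora "m+1" ?s] by auto
    have s1: "s1 y = s y" if "y \<le> m" for y using 1(3)[of y] that by simp
    have pre: "exec ora (Assign (m+1) (Var m)) s ?s 1 {}"
      by (rule exec_Assign) simp
    show "\<exists>s' n. exec ora (?P m) s s' n {} \<and> s' m = (if c (s m) = Nl then f (s m) else g (s m)) \<and>
           (\<forall>y<m. s' y = s y) \<and> n \<le> T0 (s m) + T (s m) + T' (s m) + 2"
    proof (cases "c (s m) = Nl")
      case True
      obtain s2 n2 where 2: "exec ora (P m) s1 s2 n2 {}" "s2 m = f (s1 m)"
          "\<And>y. y < m \<Longrightarrow> s2 y = s1 y" "n2 \<le> T (s1 m)"
        using implementsE[OF f(1)] by metis
      have "exec ora (?P m) s s2 (1 + (n1 + (n2 + 1))) {}"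
        by (rule exec_Seq[OF pre exec_Seq[OF 1(1) exec.CondFalse[OF _ 2(1)]]])
          (use 1(2) True in simp)
      then show ?thesis using 1 2 s1 True by (intro exI[of _ s2] exI[of _ "1 + (n1 + (n2 + 1))"]) auto
    next
      case False
      obtain s2 n2 where 2: "exec ora (P' m) s1 s2 n2 {}" "s2 m = g (s1 m)"
          "\<And>y. y < m \<Longrightarrow> s2 y = s1 y" "n2 \<le> T' (s1 m)"
        using implementsE[OF g(1)] by metis
      have "exec ora (?P m) s s2 (1 + (n1 + (n2 + 1))) {}"
        by (rule exec_Seq[OF pre exec_Seq[OF 1(1) exec.CondTrue[OF _ 2(1)]]])
          (use 1(2) False in simp)
      then show ?thesis using 1 2 s1 False by (intro exI[of _ s2] exI[of _ "1 + (n1 + (n2 + 1))"]) auto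
    qed
  qed
qed

lemmas ptime_intros = ptime_id ptime_const ptime_left ptime_right ptime_Pr ptime_if

abbreviation loop :: "(dtree \<Rightarrow> dtree) \<Rightarrow> dtree \<Rightarrow> dtree" where
  "loop g \<equiv> while (\<lambda>d. left d \<noteq> Nl) g"

text \<open>Polynomially many polynomial rounds may still take exponential time if each round
  enlarges the state. Hence two quantities: \<mu> bounds the number of rounds, and the potential
  \<Phi>, which never increases, bounds the size of every state that is reached.\<close>

lemma ptime_loop:
  assumes g: "ptime g"
    and less: "\<And>d. left d \<noteq> Nl \<Longrightarrow> \<mu> (g d) < \<mu> d" and "pbounded \<mu>"
    and pot: "\<And>d. left d \<noteq> Nl \<Longrightarrow> \<Phi> (g d) \<le> \<Phi> d" "\<And>d. size d \<le> \<Phi> d" and "pbounded \<Phi>"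
  shows "ptime (loop g)"
proof -
  obtain P T where P: "implements P g T" "pbounded T" using ptimeE[OF g] .
  obtain e where e: "\<And>d. T d \<le> (size d + 2) ^ e" using P unfolding pbounded_def by blast
  \<comment> \<open>Bounds the cost of any round by the potential of the initial state; the extra 1
    pays for the loop test.\<close>
  define B where "B d = (\<Phi> d + 2) ^ e + 1" for d
  have T: "T d < B d" for d
  proof -
    have "(size d + 2) ^ e \<le> (\<Phi> d + 2) ^ e" by (rule power_mono) (simp_all add: pot)
    then show ?thesis using e[of d] unfolding B_def by linarith
  qed
  have B: "B (g d) \<le> B d" if "left d \<noteq> Nl" for d
    unfolding B_def using pot(1)[OF that] by (simp add: power_mono)
  show ?thesis
  proof (rule ptimeI[where T = "\<lambda>d. \<mu> d * B d + 1" and P = "\<lambda>m. While (ELeft (Var m)) (P m)"])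
    show "pbounded (\<lambda>d. \<mu> d * B d + 1)" unfolding B_def by (intro pbounded_intros assms)
    have "size (loop g d) \<le> \<Phi> d" for d
    proof (induction "\<mu> d" arbitrary: d rule: less_induct)
      case less
      show ?case
      proof (cases "left d = Nl")
        case True
        then show ?thesis using pot(2) by (subst while_unfold) simp
      next
        case False
        then show ?thesis using less[OF assms(2)] pot(1)[OF False]
          by (subst while_unfold) (simp add: order_trans)
      qed
    qed
    then show "pbounded (\<lambda>d. size (loop g d))" by (rule pbounded_mono[OF \<open>pbounded \<Phi>\<close>])
    fix ora and m :: nat and s :: store
    show "\<exists>s' n. exec ora (While (ELeft (Var m)) (P m)) s s' n {} \<and> s' m = loop g (s m) \<and>
           (\<forall>y<m. s' y = s y) \<and> n \<le> \<mu> (s m) * B (s m) + 1"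
    proof (induction "\<mu> (s m)" arbitrary: s rule: less_induct)
      case less
      show ?case
      proof (cases "left (s m) = Nl")
        case True
        then show ?thesis
          using exec.WhileFalse[of "ELeft (Var m)" s ora "P m"]
          by (subst while_unfold) (auto intro!: exI)
      next
        case False
        obtain s1 n1 where 1: "exec ora (P m) s s1 n1 {}" "s1 m = g (s m)"
            "\<And>y. y < m \<Longrightarrow> s1 y = s y" "n1 \<le> T (s m)"
          using implementsE[OF P(1)] by metis
        have lt: "\<mu> (s1 m) < \<mu> (s m)" using assms(2)[OF False] 1 by simp
        obtain s2 n2 where 2: "exec ora (While (ELeft (Var m)) (P m)) s1 s2 n2 {}"
            "s2 m = loop g (s1 m)" "\<forall>y<m. s2 y = s1 y" "n2 \<le> \<mu> (s1 m) * B (s1 m) + 1"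
          using less[of s1] lt by blast
        have "exec ora (While (ELeft (Var m)) (P m)) s s2 (n1 + n2 + 1) {}"
          using exec.WhileTrue[OF _ 1(1) 2(1)] False by simp
        moreover have "s2 m = loop g (s m)" using 1 2 False by (subst while_unfold) simp
        moreover have "n1 + n2 + 1 \<le> \<mu> (s m) * B (s m) + 1"
        proof -
          have "n2 \<le> \<mu> (s1 m) * B (s m) + 1"
            using 2(4) B[OF False] 1(2) by (metis add_le_mono1 le_trans mult_le_mono2)
          moreover have "n1 + 1 \<le> B (s m)" using 1(4) T[of "s m"] by simp
          moreover have "(\<mu> (s1 m) + 1) * B (s m) \<le> \<mu> (s m) * B (s m)"
            using lt by (intro mult_right_mono) auto
          ultimately show ?thesis by (simp add: algebra_simps)
        qed
        ultimately show ?thesis using 1 2 by (intro exI[of _ s2] exI[of _ "n1 + n2 + 1"]) simp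
      qed
    qed
  qed
qed

section \<open>Folds over encoded lists\<close>

fun dfold :: "(dtree \<Rightarrow> dtree \<Rightarrow> dtree) \<Rightarrow> dtree \<Rightarrow> dtree \<Rightarrow> dtree" where
  "dfold f Nl a = a"
| "dfold f (Pr x l) a = dfold f l (f x a)"

lemma dfold_enc_list [simp]: "dfold f (enc_list xs) a = fold f xs a"
  by (induction xs arbitrary: a) auto

text \<open>The accumulator may grow only additively, by an amount linear in the current entry and
  in the parameter; multiplicative growth would be exponential over the list. The parameter
  \<open>e\<close> replaces a closure: data used by the folded function must travel with the
  state.\<close>

lemma ptime_dfold:
  assumes G: "ptime (\<lambda>d. G (left d) (left (right d)) (right (right d)))"
    and size: "\<And>e x a. size (G e x a) \<le> size a + K * (size x + size e + 1)"
    and "ptime e" "ptime l" "ptime a"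
  shows "ptime (\<lambda>d. dfold (G (e d)) (l d) (a d))"
proof -
  \<comment> \<open>The state is \<open>Pr l (Pr e a)\<close>: the rest of the list comes first
    because \<open>loop\<close> stops when the left component is \<open>Nl\<close>.\<close>
  define g where "g d = Pr (right (left d)) (Pr (left (right d))
      (G (left (right d)) (left (left d)) (right (right d))))" for d
  have "ptime (\<lambda>d. G (left (right d)) (left (left d)) (right (right d)))"
    using ptime_comp[OF G, of "\<lambda>d. Pr (left (right d)) (Pr (left (left d)) (right (right d)))"]
    by (simp add: ptime_intros)
  then have g: "ptime g" unfolding g_def by (intro ptime_intros)
  \<comment> \<open>The last summand reserves the growth still to come. Consuming the entry
    \<open>x\<close> releases K (size x + 1) (size e + 1), which covers what \<open>G\<close> adds
    to the accumulator.\<close>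
  define \<Phi> where "\<Phi> d = size (left d) + size (left (right d)) + size (right (right d)) + 2 +
      K * (size (left d) * (size (left (right d)) + 1))" for d
  have "ptime (loop g)"
  proof (rule ptime_loop[OF g, where \<mu> = "\<lambda>d. size (left d)" and \<Phi> = \<Phi>])
    have pb: "pbounded (\<lambda>d. size (left d))" "pbounded (\<lambda>d. size (left (right d)))"
      "pbounded (\<lambda>d. size (right (right d)))"
      by (rule pbounded_mono[OF pbounded_size]; meson size_left_right order_trans)+
    show "pbounded (\<lambda>d. size (left d))" "pbounded \<Phi>"
      unfolding \<Phi>_def by (intro pbounded_intros pb)+
    show "size d \<le> \<Phi> d" for d
      by (cases d; cases "right d") (auto simp: \<Phi>_def)
    fix d assume "left d \<noteq> Nl"
    then obtain x l' where d: "left d = Pr x l'" by (cases "left d") auto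
    then show "size (left (g d)) < size (left d)" by (simp add: g_def)
    show "\<Phi> (g d) \<le> \<Phi> d"
      using size[of "left (right d)" x "right (right d)"] d
      by (simp add: \<Phi>_def g_def algebra_simps)
  qed
  moreover have "loop g (Pr l (Pr e a)) = Pr Nl (Pr e (dfold (G e) l a))" for e l a
    by (induction l arbitrary: a) (subst while_unfold; simp add: g_def)+
  then have "dfold (G e) l a = right (right (loop g (Pr l (Pr e a))))" for e l a
    by simp
  ultimately show ?thesis
    using ptime_comp[of "loop g" "\<lambda>d. Pr (l d) (Pr (e d) (a d))"] by (simp add: ptime_intros assms)
qed


section \<open>Numbers, lists and the partition into pieces as tree functions\<close>

lemma size_left_add_right: "size (left d) + size (right d) \<le> size d"
  by (cases d) simp_all

lemma size_dfold_le:
  assumes "\<And>x a. size (f x a) \<le> size a + size x + 1"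
  shows "size (dfold f l a) \<le> size a + size l"
proof (induction l arbitrary: a)
  case (Pr x l)
  then show ?case using assms[of x a] by (auto intro!: order_trans[OF Pr.IH(2)])
qed simp

text \<open>The state pairs the unmatched rest of the second list with a non-\<open>Nl\<close>
  token; a mismatch collapses it to \<open>Nl\<close>. The token tells a complete match, where the
  rest is \<open>Nl\<close> too, from a failure.\<close>

definition dequal_step :: "dtree \<Rightarrow> dtree \<Rightarrow> dtree" where
  "dequal_step x p =
     (if left p = Nl then Nl
      else if x = Nl then if left (left p) = Nl then Pr (right (left p)) (right p) else Nl
      else if left (left p) = Nl then Nl else Pr (right (left p)) (right p))"

definition dequal :: "dtree \<Rightarrow> dtree \<Rightarrow> dtree" where
  "dequal a b =
     (if left (dfold dequal_step a (Pr b (Pr Nl Nl))) = Nl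
      then right (dfold dequal_step a (Pr b (Pr Nl Nl))) else Nl)"

lemma dequal_enc_bool:
  "dequal (enc_list (map enc_bool xs)) (enc_list (map enc_bool ys)) \<noteq> Nl \<longleftrightarrow> xs = ys"
proof -
  define ok where "ok p \<longleftrightarrow> left p = Nl \<and> right p \<noteq> Nl" for p
  have Nl: "fold dequal_step zs Nl = Nl" for zs
    by (induction zs) (auto simp: dequal_step_def)
  have step: "dequal_step (enc_bool x) (Pr (Pr (enc_bool y) l) t) = (if x = y then Pr l t else Nl)"
    for x y l t
    by (cases x; cases y) (simp_all add: dequal_step_def)
  have "ok (fold dequal_step (map enc_bool xs) (Pr (enc_list (map enc_bool ys)) (Pr Nl Nl))) \<longleftrightarrow> xs = ys"
  proof (induction xs arbitrary: ys)
    case Nil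
    then show ?case by (cases ys) (simp_all add: ok_def)
  next
    case (Cons x xs)
    show ?case
    proof (cases ys)
      case Nil
      moreover have "dequal_step z (Pr Nl t) = Nl" for z t by (simp add: dequal_step_def)
      ultimately show ?thesis by (simp add: Nl ok_def)
    next
      case (Cons y zs)
      then show ?thesis using Cons.IH[of zs] by (simp add: step Nl ok_def)
    qed
  qed
  then show ?thesis by (auto simp: dequal_def ok_def)
qed

lemma bits_inject: "bits a = bits b \<Longrightarrow> a = b"
proof (induction a arbitrary: b rule: less_induct)
  case (less a)
  show ?case
  proof (cases "a = 0 \<or> b = 0")
    case True
    then show ?thesis using less.prems by (auto simp: bits.simps[of a] bits.simps[of b] split: if_splits)
  next
    case False
    then have "odd a = odd b" "bits (a div 2) = bits (b div 2)"
      using less.prems by (auto simp: bits.simps[of a] bits.simps[of b])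
    moreover from this have "a div 2 = b div 2" using less.IH False by simp
    ultimately show ?thesis by (metis odd_two_times_div_two_succ even_two_times_div_two)
  qed
qed

lemma dequal_enc_nat [simp]: "dequal (enc_nat a) (enc_nat b) = Nl \<longleftrightarrow> a \<noteq> b"
  using dequal_enc_bool bits_inject unfolding enc_nat_def by metis

lemma ptime_dequal:
  assumes "ptime f" "ptime g" shows "ptime (\<lambda>d. dequal (f d) (g d))"
proof -
  have "ptime (\<lambda>d. dfold dequal_step (f d) (Pr (g d) (Pr Nl Nl)))"
  proof (rule ptime_dfold[where G = "\<lambda>_. dequal_step" and K = 1 and e = "\<lambda>_. Nl"])
    fix e x a
    show "size (dequal_step x a) \<le> size a + 1 * (size x + size e + 1)"
      using size_left_right(2)[of "left a"] by (cases a) (auto simp: dequal_step_def)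
  qed (auto simp: dequal_step_def intro!: ptime_intros assms)
  then show ?thesis unfolding dequal_def by (intro ptime_intros)
qed

definition dmember :: "dtree \<Rightarrow> dtree \<Rightarrow> dtree" where
  "dmember x l = dfold (\<lambda>y a. if dequal x y = Nl then a else Pr Nl Nl) l Nl"

lemma dmember_enc_nat [simp]:
  "dmember (enc_nat x) (enc_list (map enc_nat ys)) = Nl \<longleftrightarrow> x \<notin> set ys"
proof -
  have "fold (\<lambda>y a. if dequal (enc_nat x) y = Nl then a else Pr Nl Nl) (map enc_nat ys) a = Nl \<longleftrightarrow>
    x \<notin> set ys \<and> a = Nl" for a
    by (induction ys arbitrary: a) auto
  then show ?thesis by (simp add: dmember_def)
qed

lemma ptime_dmember:
  assumes "ptime f" "ptime g" shows "ptime (\<lambda>d. dmember (f d) (g d))"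
  unfolding dmember_def
  by (rule ptime_dfold[where G = "\<lambda>x y a. if dequal x y = Nl then a else Pr Nl Nl" and K = 1])
    (auto intro!: ptime_intros assms ptime_dequal)

text \<open>Accumulating in front reverses the list. This is harmless for vertex and edge lists,
  whose order in an encoding is arbitrary.\<close>

definition dfilter :: "(dtree \<Rightarrow> dtree) \<Rightarrow> dtree \<Rightarrow> dtree" where
  "dfilter P l = dfold (\<lambda>x a. if P x = Nl then a else Pr x a) l Nl"

lemma dfilter_enc_list [simp]:
  "dfilter P (enc_list xs) = enc_list (rev (filter (\<lambda>x. P x \<noteq> Nl) xs))"
proof -
  have "fold (\<lambda>x a. if P x = Nl then a else Pr x a) xs (enc_list ys) =
    enc_list (rev (filter (\<lambda>x. P x \<noteq> Nl) xs) @ ys)" for ys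
  proof (induction xs arbitrary: ys)
    case (Cons x xs)
    show ?case using Cons[of "x # ys"] Cons[of ys] by simp
  qed simp
  from this[of "[]"] show ?thesis by (simp add: dfilter_def)
qed

lemma size_dfilter: "size (dfilter P l) \<le> size l"
  unfolding dfilter_def by (rule order_trans[OF size_dfold_le]) auto

lemma ptime_dfilter:
  assumes "ptime (\<lambda>d. P (left d) (right d))" "ptime e" "ptime l"
  shows "ptime (\<lambda>d. dfilter (P (e d)) (l d))"
  unfolding dfilter_def
proof (rule ptime_dfold[where G = "\<lambda>e x a. if P e x = Nl then a else Pr x a" and K = 1])
  have "ptime (\<lambda>d. P (left d) (left (right d)))"
    using ptime_comp[OF assms(1), of "\<lambda>d. Pr (left d) (left (right d))"] by (simp add: ptime_intros)
  then show "ptime (\<lambda>d. if P (left d) (left (right d)) = Nl then right (right d)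
      else Pr (left (right d)) (right (right d)))" by (intro ptime_intros)
qed (auto intro!: ptime_intros assms)

definition dmap :: "(dtree \<Rightarrow> dtree) \<Rightarrow> dtree \<Rightarrow> dtree" where
  "dmap f l = dfold (\<lambda>x a. Pr (f x) a) l Nl"

lemma dmap_enc_list [simp]: "dmap f (enc_list xs) = enc_list (rev (map f xs))"
proof -
  have "fold (\<lambda>x a. Pr (f x) a) xs (enc_list ys) = enc_list (rev (map f xs) @ ys)" for ys
  proof (induction xs arbitrary: ys)
    case (Cons x xs)
    show ?case using Cons[of "f x # ys"] by simp
  qed simp
  from this[of "[]"] show ?thesis by (simp add: dmap_def)
qed

lemma ptime_dmap:
  assumes "ptime (\<lambda>d. f (left d) (right d))" "ptime e" "ptime l"
    and "\<And>e x. size (f e x) \<le> size x + size e + 1"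
  shows "ptime (\<lambda>d. dmap (f (e d)) (l d))"
  unfolding dmap_def
proof (rule ptime_dfold[where G = "\<lambda>e x a. Pr (f e x) a" and K = 2])
  have "ptime (\<lambda>d. f (left d) (left (right d)))"
    using ptime_comp[OF assms(1), of "\<lambda>d. Pr (left d) (left (right d))"] by (simp add: ptime_intros)
  then show "ptime (\<lambda>d. Pr (f (left d) (left (right d))) (right (right d)))"
    by (intro ptime_intros)
  fix e x a
  show "size (Pr (f e x) a) \<le> size a + 2 * (size x + size e + 1)"
    using assms(4)[of e x] by simp
qed (auto intro!: ptime_intros assms)

definition drevappend :: "dtree \<Rightarrow> dtree \<Rightarrow> dtree" where
  "drevappend a b = dfold Pr a b"

lemma drevappend_enc_list [simp]:
  "drevappend (enc_list xs) (enc_list ys) = enc_list (rev xs @ ys)"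
proof -
  have "fold Pr xs (enc_list ys) = enc_list (rev xs @ ys)" for ys
  proof (induction xs arbitrary: ys)
    case (Cons x xs)
    show ?case using Cons[of "x # ys"] by simp
  qed simp
  then show ?thesis by (simp add: drevappend_def)
qed

lemma size_drevappend: "size (drevappend a b) \<le> size a + size b"
  unfolding drevappend_def by (rule order_trans[OF size_dfold_le]) auto

lemma ptime_drevappend:
  assumes "ptime f" "ptime g" shows "ptime (\<lambda>d. drevappend (f d) (g d))"
  unfolding drevappend_def
  by (rule ptime_dfold[where G = "\<lambda>_. Pr" and K = 1 and e = "\<lambda>_. Nl"])
    (auto intro!: ptime_intros assms)

text \<open>Numbers are also represented in unary, by lists of that length with arbitrary entries.\<close>

definition dtimes :: "dtree \<Rightarrow> dtree \<Rightarrow> dtree" where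
  "dtimes a b = dfold (\<lambda>_ c. drevappend b c) a Nl"

lemma dtimes_enc_list:
  "\<exists>zs. dtimes (enc_list xs) (enc_list ys) = enc_list zs \<and> length zs = length xs * length ys"
proof -
  have "\<exists>zs. fold (\<lambda>_ c. drevappend (enc_list ys) c) xs (enc_list vs) = enc_list zs \<and>
    length zs = length xs * length ys + length vs" for vs
  proof (induction xs arbitrary: vs)
    case (Cons x xs)
    show ?case using Cons[of "rev ys @ vs"] by (simp add: add_ac)
  qed auto
  from this[of "[]"] show ?thesis by (simp add: dtimes_def)
qed

lemma ptime_dtimes:
  assumes "ptime f" "ptime g" shows "ptime (\<lambda>d. dtimes (f d) (g d))"
  unfolding dtimes_def
proof (rule ptime_dfold[where G = "\<lambda>b _ c. drevappend b c" and K = 1])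
  fix e x a
  show "size (drevappend e a) \<le> size a + 1 * (size x + size e + 1)"
    using size_drevappend[of e a] by simp
qed (auto intro!: ptime_intros assms ptime_drevappend)

text \<open>Truncated subtraction of unary numbers: one entry of \<open>a\<close> is dropped for
  each entry of \<open>b\<close>, and the remainder is not \<open>Nl\<close> exactly if
  \<open>a\<close> is longer.\<close>

definition dlonger :: "dtree \<Rightarrow> dtree \<Rightarrow> dtree" where
  "dlonger a b = dfold (\<lambda>_ c. right c) b a"

lemma dlonger_enc_list [simp]:
  "dlonger (enc_list xs) (enc_list ys) = Nl \<longleftrightarrow> length xs \<le> length ys"
proof -
  have "fold (\<lambda>_ c. right c) ys (enc_list xs) = enc_list (drop (length ys) xs)"
  proof (induction ys arbitrary: xs)
    case (Cons y ys)
    show ?case using Cons[of "tl xs"] by (cases xs) auto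
  qed simp
  moreover have "enc_list zs = Nl \<longleftrightarrow> zs = []" for zs by (cases zs) auto
  ultimately show ?thesis by (simp add: dlonger_def)
qed

lemma ptime_dlonger:
  assumes "ptime f" "ptime g" shows "ptime (\<lambda>d. dlonger (f d) (g d))"
  unfolding dlonger_def
  by (rule ptime_dfold[where G = "\<lambda>_ _ c. right c" and K = 1 and e = "\<lambda>_. Nl"])
    (auto intro!: ptime_intros assms le_SucI trans_le_add1 size_left_right)

lemma left_right_enc_nat_pair [simp]:
  "left (enc_nat_pair p) = enc_nat (fst p)" "right (enc_nat_pair p) = enc_nat (snd p)"
  by (simp_all add: enc_nat_pair_def)

section \<open>The maximum degree and the cut-off in unary\<close>

definition dincident :: "dtree \<Rightarrow> dtree \<Rightarrow> dtree" where
  "dincident v e = (if dequal v (left e) = Nl then dequal v (right e) else Pr Nl Nl)"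

text \<open>A longest list of edges at a single vertex is the maximum degree in unary. Entries of
  \<open>vs\<close> are pairs of a vertex and its capacity, hence \<open>left v\<close>.\<close>

definition dmax_star :: "dtree \<Rightarrow> dtree \<Rightarrow> dtree" where
  "dmax_star vs es = dfold (\<lambda>v a. if dlonger (dfilter (dincident (left v)) es) a = Nl then a
     else dfilter (dincident (left v)) es) vs Nl"

definition incident :: "nat \<Rightarrow> (nat \<times> nat) list \<Rightarrow> (nat \<times> nat) list" where
  "incident v es = filter (\<lambda>(a, b). v = a \<or> v = b) es"

lemma dfilter_dincident:
  "dfilter (dincident (enc_nat v)) (enc_list (map enc_nat_pair es)) =
     enc_list (map enc_nat_pair (rev (incident v es)))"
proof -
  have "(dincident (enc_nat v) (enc_nat_pair e) \<noteq> Nl) = (case e of (a, b) \<Rightarrow> v = a \<or> v = b)" for e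
    by (cases e) (auto simp: dincident_def)
  then show ?thesis by (simp add: filter_map o_def incident_def rev_map)
qed

lemma dmax_star_enc:
  "\<exists>zs. dmax_star (enc_list (map (\<lambda>v. enc_nat_pair (v, c v)) vs)) (enc_list (map enc_nat_pair es)) =
     enc_list zs \<and> length zs = Max (insert 0 ((\<lambda>v. length (incident v es)) ` set vs))"
proof -
  define E where "E = enc_list (map enc_nat_pair es)"
  have star: "dfilter (dincident (enc_nat v)) E = enc_list (map enc_nat_pair (rev (incident v es)))" for v
    unfolding E_def by (rule dfilter_dincident)
  let ?f = "\<lambda>v a. if dlonger (dfilter (dincident (left v)) E) a = Nl
     then a else dfilter (dincident (left v)) E"
  have "\<exists>zs. fold ?f (map (\<lambda>v. enc_nat_pair (v, c v)) vs) (enc_list ys) = enc_list zs \<and>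
     length zs = Max (insert (length ys) ((\<lambda>v. length (incident v es)) ` set vs))" for ys
  proof (induction vs arbitrary: ys)
    case Nil
    then show ?case by auto
  next
    case (Cons v vs)
    let ?s = "map enc_nat_pair (rev (incident v es))"
    let ?A = "(\<lambda>v. length (incident v es)) ` set vs"
    define ys' where "ys' = (if length ?s \<le> length ys then ys else ?s)"
    have "fold ?f (map (\<lambda>v. enc_nat_pair (v, c v)) (v # vs)) (enc_list ys) =
      fold ?f (map (\<lambda>v. enc_nat_pair (v, c v)) vs) (enc_list ys')"
      by (simp add: star ys'_def)
    moreover have "Max (insert (length ys') ?A) = Max (insert (length ys) (insert (length (incident v es)) ?A))"
      by (cases "?A = {}") (auto simp: ys'_def)
    ultimately show ?case using Cons[of ys'] by simp
  qed
  from this[of "[]"] show ?thesis unfolding dmax_star_def E_def[symmetric] by simp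
qed

lemma ptime_dmax_star:
  assumes "ptime f" "ptime g" shows "ptime (\<lambda>d. dmax_star (f d) (g d))"
proof -
  have "ptime (\<lambda>d. dincident (left d) (right d))"
    unfolding dincident_def by (intro ptime_intros ptime_dequal)
  from ptime_dfilter[OF this, of "\<lambda>d. left (left (right d))" left]
  have star: "ptime (\<lambda>d. dfilter (dincident (left (left (right d)))) (left d))"
    by (simp add: ptime_intros)
  show ?thesis
    unfolding dmax_star_def
  proof (rule ptime_dfold[where K = 1 and G = "\<lambda>es v a.
        if dlonger (dfilter (dincident (left v)) es) a = Nl then a
        else dfilter (dincident (left v)) es"])
    fix e x a
    show "size (if dlonger (dfilter (dincident (left x)) e) a = Nl then a
        else dfilter (dincident (left x)) e) \<le> size a + 1 * (size x + size e + 1)"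
      using size_dfilter[of "dincident (left x)" e] by simp
  qed (auto intro!: ptime_intros assms ptime_dlonger star)
qed

text \<open>The unary number k (\<Delta> + 1)^2; the \<open>Nl\<close> put in front of each star
  supplies the + 1.\<close>

definition dunit :: "dtree \<Rightarrow> dtree \<Rightarrow> dtree" where
  "dunit k G = dtimes k (dtimes (Pr Nl (dmax_star (left G) (right G)))
     (Pr Nl (dmax_star (left G) (right G))))"

lemma dunit_enc:
  "\<exists>zs. dunit (enc_list ks) (Pr (enc_list (map (\<lambda>v. enc_nat_pair (v, c v)) vs))
       (enc_list (map enc_nat_pair es))) = enc_list zs \<and>
     length zs = length ks * (Max (insert 0 ((\<lambda>v. length (incident v es)) ` set vs)) + 1) ^ 2"
proof -
  obtain zs where zs: "dmax_star (enc_list (map (\<lambda>v. enc_nat_pair (v, c v)) vs))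
      (enc_list (map enc_nat_pair es)) = enc_list zs"
    "length zs = Max (insert 0 ((\<lambda>v. length (incident v es)) ` set vs))"
    using dmax_star_enc by blast
  obtain ys where "dtimes (enc_list (Nl # zs)) (enc_list (Nl # zs)) = enc_list ys"
    "length ys = length (Nl # zs) * length (Nl # zs)"
    using dtimes_enc_list by blast
  then show ?thesis
    using dtimes_enc_list[of ks ys] zs by (simp add: dunit_def power2_eq_square)
qed

lemma ptime_dunit: "ptime f \<Longrightarrow> ptime (\<lambda>d. dunit k (f d))"
  unfolding dunit_def by (intro ptime_intros ptime_dtimes ptime_dmax_star)

text \<open>
  A frame \<open>Pr b (Pr ts acc)\<close> belongs to a node with bag \<open>b\<close>: \<open>ts\<close> are its children that have yet to
  be visited, and \<open>acc\<close> holds the vertices from the visited ones that are not in a piece so far.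
\<close>

definition dmerge :: "dtree \<Rightarrow> dtree \<Rightarrow> dtree" where
  "dmerge fr fr' = drevappend (dfilter (\<lambda>x. if dmember x (left fr') = Nl then Pr Nl Nl else Nl) (left fr))
     (drevappend (right (right fr)) (right (right fr')))"

text \<open>The language has loops but no recursion, so the recursion of \<open>pieces\<close> runs
  on an explicit stack of frames: a pop merges a finished child into its parent or emits a piece, a
  push opens the next child. The empty stack is the halting signal of \<open>loop\<close>.\<close>

definition dstep :: "dtree \<Rightarrow> dtree" where
  "dstep st =
     (let stack = left st; fr = left stack; fr' = left (right stack); u = left (right st);
          out = right (right st) in
      if left (right fr) = Nl then
        if right stack = Nl then Pr Nl (Pr u out)
        else if dlonger (dmerge fr fr') (dtimes (left fr') u) = Nl
        then Pr (Pr (Pr (left fr') (Pr (left (right fr')) (dmerge fr fr'))) (right (right stack))) (Pr u out)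
        else Pr (Pr (Pr (left fr') (Pr (left (right fr')) Nl)) (right (right stack)))
               (Pr u (Pr (dmerge fr fr') out))
      else Pr (Pr (Pr (left (left (left (right fr)))) (Pr (right (left (left (right fr)))) Nl))
                 (Pr (Pr (left fr) (Pr (right (left (right fr))) (right (right fr)))) (right stack)))
             (Pr u out))"

text \<open>The bottom frame is the virtual parent of the root, with empty bag and \<open>t\<close>
  as its only child.\<close>

definition dpieces :: "dtree \<Rightarrow> dtree \<Rightarrow> dtree" where
  "dpieces u t = right (right (loop dstep (Pr (Pr (Pr Nl (Pr (Pr t Nl) Nl)) Nl) (Pr u Nl))))"

lemma size_dmerge:
  "size (dmerge fr fr') \<le> size (left fr) + size (right (right fr)) + size (right (right fr'))"
  unfolding dmerge_def
  by (intro order_trans[OF size_drevappend] order_trans[OF add_mono[OF size_dfilter size_drevappend]])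
    simp

lemma ptime_dmerge:
  assumes "ptime f" "ptime g" shows "ptime (\<lambda>d. dmerge (f d) (g d))"
proof -
  have "ptime (\<lambda>d. if dmember (right d) (left (left d)) = Nl then Pr Nl Nl else Nl)"
    by (intro ptime_intros ptime_dmember)
  note new = ptime_dfilter[where P = "\<lambda>fr' x. if dmember x (left fr') = Nl then Pr Nl Nl else Nl", OF this]
  show ?thesis unfolding dmerge_def by (intro ptime_drevappend new ptime_intros assms)
qed

lemma ptime_dstep: "ptime dstep"
  unfolding dstep_def Let_def by (intro ptime_intros ptime_dlonger ptime_dtimes ptime_dmerge)

text \<open>A push gains a frame, which counts 1, but loses the pair that held the child in the list
  of unvisited subtrees, which counts 2; a pop loses a frame.\<close>

fun stack_measure :: "dtree \<Rightarrow> nat" where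
  "stack_measure Nl = 0"
| "stack_measure (Pr fr s) = 2 * size (left (right fr)) + 1 + stack_measure s"

lemma stack_measure_le: "stack_measure s \<le> 2 * size s"
proof (induction s)
  case (Pr fr s)
  have "size (left (right fr)) \<le> size fr" using size_left_right order_trans by blast
  then show ?case using Pr by simp
qed simp

lemma ptime_dpieces:
  assumes "ptime f" "ptime g" shows "ptime (\<lambda>d. dpieces (f d) (g d))"
proof -
  define \<mu> where "\<mu> d = stack_measure (left d)" for d
  have "ptime (loop dstep)"
  \<comment> \<open>A transition adds at most 20 to the size of the state and lowers the measure by
    at least 1, so weighting the measure by 20 makes the potential nonincreasing.\<close>
  proof (rule ptime_loop[OF ptime_dstep, where \<mu> = \<mu> and \<Phi> = "\<lambda>d. size d + 20 * \<mu> d"])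
    have "pbounded (\<lambda>d. 2 * size d)" by (intro pbounded_intros)
    moreover have "\<mu> d \<le> 2 * size d" for d
      using stack_measure_le[of "left d"] size_left_right(1)[of d] by (simp add: \<mu>_def)
    ultimately show "pbounded \<mu>" by (rule pbounded_mono)
    then show "pbounded (\<lambda>d. size d + 20 * \<mu> d)" by (intro pbounded_intros)
    show "size d \<le> size d + 20 * \<mu> d" for d by simp
    fix d assume "left d \<noteq> Nl"
    then obtain fr s r where d: "d = Pr (Pr fr s) r" by (metis left.cases left.simps)
    have r: "size (left r) + size (right r) \<le> size r" by (rule size_left_add_right)
    have fr: "size (left fr) + size (right fr) \<le> size fr"
      "size (left (right fr)) + size (right (right fr)) \<le> size (right fr)"
      by (rule size_left_add_right)+
    have "\<mu> (dstep d) < \<mu> d \<and> size (dstep d) \<le> size d + 20"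
    proof (cases "left (right fr)")
      case Nl
      show ?thesis
      proof (cases s)
        case Nl
        then show ?thesis
          using \<open>left (right fr) = Nl\<close> d r by (simp add: dstep_def Let_def \<mu>_def)
      next
        case (Pr fr' s')
        have fr': "size (left fr') + size (right fr') \<le> size fr'"
          "size (left (right fr')) + size (right (right fr')) \<le> size (right fr')"
          by (rule size_left_add_right)+
        show ?thesis
          using Nl Pr d r fr fr' size_dmerge[of fr fr'] by (simp add: dstep_def Let_def \<mu>_def)
      qed
    next
      case (Pr t rest)
      have "size (left t) + size (right t) \<le> size t" by (rule size_left_add_right)
      then show ?thesis using Pr d r fr by (simp add: dstep_def Let_def \<mu>_def)
    qed
    then show "\<mu> (dstep d) < \<mu> d" "size (dstep d) + 20 * \<mu> (dstep d) \<le> size d + 20 * \<mu> d"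
      by auto
  qed
  from ptime_comp[OF this, of "\<lambda>d. Pr (Pr (Pr Nl (Pr (Pr (g d) Nl) Nl)) Nl) (Pr (f d) Nl)"]
  show ?thesis unfolding dpieces_def by (intro ptime_intros assms) (simp add: ptime_intros assms)
qed

text \<open>
  Each piece comes with the bag that separates it from the pieces after it.
\<close>

fun pieces :: "nat \<Rightarrow> 'a list \<Rightarrow> 'a list rtree list \<Rightarrow> 'a list \<Rightarrow> 'a list \<times> ('a list \<times> 'a list) list" where
  "pieces u b' [] acc = (acc, [])"
| "pieces u b' (Node b ts # rest) acc =
     (let (a, ps) = pieces u b ts [];
          c = filter (\<lambda>x. x \<notin> set b') b @ rev a @ acc;
          (r, ps') = pieces u b' rest (if length c \<le> length b' * u then c else []) in
      (r, ps @ (if length c \<le> length b' * u then [] else [(b', c)]) @ ps'))"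

text \<open>Working off the children of the top frame leaves the stack \<open>s\<close> below it
  untouched and only extends the output. Both are arbitrary here, so that the induction hypothesis
  applies to a child whose parent frame is on the stack. Only the pieces are emitted, latest first;
  their bags in \<open>ps\<close> serve the analysis.\<close>

lemma loop_dstep:
  defines "encs \<equiv> \<lambda>xs. enc_list (map enc_nat xs)"
  assumes "pieces (length us) b' ts acc = (r, ps)"
  shows "loop dstep (Pr (Pr (Pr (encs b') (Pr (enc_list (map enc_rtree ts)) (encs acc))) s)
           (Pr (enc_list us) (enc_list out))) =
         loop dstep (Pr (Pr (Pr (encs b') (Pr Nl (encs r))) s)
           (Pr (enc_list us) (enc_list (rev (map (encs \<circ> snd) ps) @ out))))"
  using assms(2)
proof (induction "length us" b' ts acc arbitrary: r ps s out rule: pieces.induct)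
  case (1 b' acc)
  then show ?case by simp
next
  case (2 b' b ts rest acc)
  obtain a ps1 where 1: "pieces (length us) b ts [] = (a, ps1)" by fastforce
  define c where "c = filter (\<lambda>x. x \<notin> set b') b @ rev a @ acc"
  define small where "small \<longleftrightarrow> length c \<le> length b' * length us"
  obtain r2 ps2 where 2: "pieces (length us) b' rest (if small then c else []) = (r2, ps2)"
    by fastforce
  have r: "r = r2" and ps: "ps = ps1 @ (if small then [] else [(b', c)]) @ ps2"
    using "2.prems" by (simp_all only: pieces.simps Let_def 1 2 prod.case prod.inject flip: c_def small_def)
  let ?fr' = "Pr (encs b') (Pr (enc_list (map enc_rtree rest)) (encs acc))"
  have merge: "dmerge (Pr (encs b) (Pr Nl (encs a))) ?fr' = encs c"
    by (simp add: dmerge_def encs_def c_def filter_map o_def if_distrib rev_map cong: if_cong)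
  obtain zs where zs: "dtimes (encs b') (enc_list us) = enc_list zs"
    "length zs = length b' * length us"
    unfolding encs_def using dtimes_enc_list[of "map enc_nat b'" us] by auto
  have longer: "dlonger (encs c) (enc_list zs) = Nl \<longleftrightarrow> small"
    using zs by (simp add: encs_def small_def)
  let ?out1 = "rev (map (encs \<circ> snd) ps1) @ out"
  have "loop dstep (Pr (Pr (Pr (encs b') (Pr (enc_list (map enc_rtree (Node b ts # rest))) (encs acc))) s)
       (Pr (enc_list us) (enc_list out))) =
     loop dstep (Pr (Pr (Pr (encs b) (Pr (enc_list (map enc_rtree ts)) (encs []))) (Pr ?fr' s))
       (Pr (enc_list us) (enc_list out)))"
    by (subst while_unfold) (simp add: dstep_def encs_def)
  also have "\<dots> = loop dstep (Pr (Pr (Pr (encs b) (Pr Nl (encs a))) (Pr ?fr' s))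
       (Pr (enc_list us) (enc_list ?out1)))"
    using "2.hyps"(1)[OF 1] by simp
  also have "\<dots> = loop dstep (Pr (Pr (Pr (encs b') (Pr (enc_list (map enc_rtree rest))
         (encs (if small then c else [])))) s)
       (Pr (enc_list us) (enc_list ((if small then [] else [encs c]) @ ?out1))))"
    using merge longer zs(1)
    by (subst while_unfold) (simp add: dstep_def Let_def encs_def)
  also have "\<dots> = loop dstep (Pr (Pr (Pr (encs b') (Pr Nl (encs r))) s)
       (Pr (enc_list us) (enc_list (rev (map (encs \<circ> snd) ps) @ out))))"
    using "2.hyps"(2)[OF 1[symmetric] refl c_def, of r2 ps2] 2 r ps by (simp add: small_def)
  finally show ?case .
qed

lemma dpieces_enc:
  assumes "pieces (length us) [] [t] [] = (r, ps)"
  shows "dpieces (enc_list us) (enc_rtree t) =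
    enc_list (rev (map (\<lambda>p. enc_list (map enc_nat (snd p))) ps))"
proof -
  have "loop dstep (Pr (Pr fr Nl) (Pr u out)) = Pr Nl (Pr u out)" if "left (right fr) = Nl" for fr u out
    using that by (subst while_unfold, subst while_unfold) (simp add: dstep_def)
  then show ?thesis
    using loop_dstep[OF assms, of Nl "[]"] by (simp add: dpieces_def o_def)
qed

section \<open>Induced subgraphs and the list of queries\<close>

definition dinduced :: "dtree \<Rightarrow> dtree \<Rightarrow> dtree" where
  "dinduced G p = Pr (dfilter (\<lambda>v. dmember (left v) p) (left G))
     (dfilter (\<lambda>e. if dmember (left e) p = Nl then Nl else dmember (right e) p) (right G))"

text \<open>The left component is the part of the solution already decided, the right one the list
  of queries. Without edges the allowed query size is 0, because it has the factor \<Delta>^2; all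
  vertices are then chosen directly.\<close>

definition dplan :: "dtree \<Rightarrow> dtree \<Rightarrow> dtree" where
  "dplan k d =
     (if right (left d) = Nl then Pr (dmap left (left (left d))) Nl
      else Pr Nl (dmap (dinduced (left d)) (dpieces (dunit k (left d)) (right d))))"

lemma ptime_dinduced: "ptime (\<lambda>d. dinduced (left d) (right d))"
proof -
  have "ptime (\<lambda>d. dmember (left (right d)) (left d))"
    by (intro ptime_intros ptime_dmember)
  note 1 = ptime_dfilter[where P = "\<lambda>p v. dmember (left v) p", OF this]
  have "ptime (\<lambda>d. if dmember (left (right d)) (left d) = Nl then Nl
      else dmember (right (right d)) (left d))"
    by (intro ptime_intros ptime_dmember)
  note 2 = ptime_dfilter[where P = "\<lambda>p e. if dmember (left e) p = Nl then Nl else dmember (right e) p",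
      OF this]
  show ?thesis unfolding dinduced_def by (intro ptime_intros 1 2)
qed

lemma ptime_dplan: "ptime (dplan k)"
proof -
  have 1: "ptime (\<lambda>d. dmap left (left (left d)))"
    by (rule ptime_dmap[where f = "\<lambda>_. left" and e = "\<lambda>_. Nl"])
      (auto intro!: ptime_intros le_SucI trans_le_add1 size_left_right)
  have 2: "ptime (\<lambda>d. dmap (dinduced (left d)) (dpieces (dunit k (left d)) (right d)))"
  proof (rule ptime_dmap[OF ptime_dinduced])
    fix e x
    show "size (dinduced e x) \<le> size x + size e + 1"
      unfolding dinduced_def dtree.size
      by (intro order_trans[OF add_mono[OF add_mono[OF size_dfilter size_dfilter] order_refl]])
        (use size_left_add_right[of e] in simp)
  qed (intro ptime_intros ptime_dpieces ptime_dunit)+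
  show ?thesis unfolding dplan_def by (intro ptime_intros 1 2)
qed

section \<open>Pieces of a tree decomposition\<close>

definition tree_verts :: "'a list rtree \<Rightarrow> 'a set" where
  "tree_verts t = (\<Union>b\<in>set_rtree t. set b)"

definition forest_verts :: "'a list rtree list \<Rightarrow> 'a set" where
  "forest_verts ts = (\<Union>t\<in>set ts. tree_verts t)"

lemma forest_verts_simps [simp]:
  "forest_verts [] = {}" "forest_verts (t # ts) = tree_verts t \<union> forest_verts ts"
  "tree_verts (Node b ts) = set b \<union> forest_verts ts"
  by (auto simp: forest_verts_def tree_verts_def)

text \<open>
  The properties of a tree decomposition of the graph with neighbourhoods \<open>N\<close> that matter for the
  subtrees \<open>ts\<close> below a node with bag \<open>b'\<close>.
\<close>

fun decomposes :: "('a \<Rightarrow> 'a set) \<Rightarrow> 'a list \<Rightarrow> 'a list rtree list \<Rightarrow> bool" where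
  "decomposes N b' [] \<longleftrightarrow> True"
| "decomposes N b' (Node b ts # rest) \<longleftrightarrow>
     distinct b \<and>
     set b' \<inter> forest_verts ts \<subseteq> set b \<and>
     (\<forall>v\<in>set b - set b'. N v \<subseteq> set b \<union> forest_verts ts) \<and>
     (set b \<union> forest_verts ts) \<inter> forest_verts rest \<subseteq> set b' \<and>
     decomposes N b ts \<and> decomposes N b' rest"

definition piece_verts :: "('a list \<times> 'a list) list \<Rightarrow> 'a set" where
  "piece_verts ps = (\<Union>p\<in>set ps. set (snd p))"

lemma piece_verts_simps [simp]:
  "piece_verts [] = {}" "piece_verts (p # ps) = set (snd p) \<union> piece_verts ps"
  "piece_verts (ps @ qs) = piece_verts ps \<union> piece_verts qs"
  by (auto simp: piece_verts_def)

lemma set_concat_pieces: "set (concat (map snd ps)) = piece_verts ps"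
  by (simp add: piece_verts_def)

lemma pieces_NodeE:
  assumes "pieces u b' (Node b ts # rest) acc = (r, ps)"
  obtains a ps1 c d ps' ps2 where
    "pieces u b ts [] = (a, ps1)" "c = filter (\<lambda>x. x \<notin> set b') b @ rev a @ acc"
    "length c \<le> length b' * u \<and> d = c \<and> ps' = [] \<or>
     length c > length b' * u \<and> d = [] \<and> ps' = [(b', c)]"
    "pieces u b' rest d = (r, ps2)" "ps = ps1 @ ps' @ ps2"
proof -
  obtain a ps1 where 1: "pieces u b ts [] = (a, ps1)" by fastforce
  define c where "c = filter (\<lambda>x. x \<notin> set b') b @ rev a @ acc"
  define small where "small \<longleftrightarrow> length c \<le> length b' * u"
  obtain r2 ps2 where 2: "pieces u b' rest (if small then c else []) = (r2, ps2)"
    by fastforce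
  have "r = r2 \<and> ps = ps1 @ (if small then [] else [(b', c)]) @ ps2"
    using assms by (simp only: pieces.simps Let_def 1 2 prod.case prod.inject flip: c_def small_def)
  then show thesis
    using that[OF 1 c_def, of "if small then c else []" "if small then [] else [(b', c)]" ps2] 2
    by (auto simp: small_def)
qed

text \<open>A vertex is collected at its topmost node: those in \<open>b'\<close> are left to the
  nodes above, and the others cannot occur again among later siblings, because different child
  subtrees share only vertices of \<open>b'\<close>. The hypothesis on \<open>acc\<close> carries
  this disjointness along the siblings.\<close>

lemma pieces_partition:
  assumes "decomposes N b' ts" "pieces u b' ts acc = (r, ps)" "distinct acc"
    and "set acc \<inter> (forest_verts ts - set b') = {}"
  shows "set r \<union> piece_verts ps = set acc \<union> (forest_verts ts - set b') \<and>
    distinct (r @ concat (map snd ps))"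
  using assms
proof (induction u b' ts acc arbitrary: r ps rule: pieces.induct)
  case (1 u b' acc)
  then show ?case by simp
next
  case (2 u b' b ts rest acc)
  from \<open>pieces u b' (Node b ts # rest) acc = (r, ps)\<close>
  obtain a ps1 c d ps' ps2 where eqs:
    "pieces u b ts [] = (a, ps1)" "c = filter (\<lambda>x. x \<notin> set b') b @ rev a @ acc"
    "length c \<le> length b' * u \<and> d = c \<and> ps' = [] \<or>
     length c > length b' * u \<and> d = [] \<and> ps' = [(b', c)]"
    "pieces u b' rest d = (r, ps2)" "ps = ps1 @ ps' @ ps2"
    by (rule pieces_NodeE)
  have dec: "distinct b" "set b' \<inter> forest_verts ts \<subseteq> set b"
    "(set b \<union> forest_verts ts) \<inter> forest_verts rest \<subseteq> set b'"
    "decomposes N b ts" "decomposes N b' rest"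
    using "2.prems"(1) by simp_all
  have sub: "set a \<union> piece_verts ps1 = forest_verts ts - set b"
    "distinct (a @ concat (map snd ps1))"
    using "2.IH"(1)[OF dec(4) eqs(1)] by auto
  have "set a \<inter> piece_verts ps1 = {}" using sub(2) by (auto simp: piece_verts_def)
  moreover have "set acc \<inter> (forest_verts ts - set b) = {}" using dec(2) "2.prems"(4) by auto
  ultimately have c: "set c = (set b - set b') \<union> set a \<union> set acc" "distinct c"
    "set c \<inter> piece_verts ps1 = {}"
    using sub dec "2.prems"(3,4) unfolding eqs(2) by (auto simp: set_concat_pieces)
  have "set c \<subseteq> (set b \<union> forest_verts ts - set b') \<union> set acc"
    using c(1) sub(1) dec(2) by blast
  moreover have "set acc \<inter> (forest_verts rest - set b') = {}" using "2.prems"(4) by auto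
  ultimately have c_rest: "set c \<inter> (forest_verts rest - set b') = {}" using dec(3) by blast
  have d: "distinct d" "set d \<inter> (forest_verts rest - set b') = {}"
    using eqs(3) c(2) c_rest by auto
  have d_eq: "d = (if length c \<le> length b' * u then c else [])" using eqs(3) by auto
  have rest: "set r \<union> piece_verts ps2 = set d \<union> (forest_verts rest - set b')"
    "distinct (r @ concat (map snd ps2))"
    using "2.IH"(2)[OF eqs(1)[symmetric] refl eqs(2) dec(5)] eqs(4) d d_eq by auto
  have sets: "set d \<union> piece_verts ps' = set c" "set d \<inter> piece_verts ps' = {}"
    "distinct (concat (map snd ps'))"
    using eqs(3) c by auto
  have "set r \<union> piece_verts ps = set acc \<union> (forest_verts (Node b ts # rest) - set b')"
  proof -
    have "set r \<union> piece_verts ps = piece_verts ps1 \<union> piece_verts ps' \<union> (set r \<union> piece_verts ps2)"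
      using eqs(5) by auto
    also have "\<dots> = piece_verts ps1 \<union> set c \<union> (forest_verts rest - set b')"
      unfolding rest using sets by auto
    also have "\<dots> = set acc \<union> (forest_verts (Node b ts # rest) - set b')"
      using c(1) sub(1) dec(2) by auto
    finally show ?thesis .
  qed
  moreover have "distinct (r @ concat (map snd ps))"
  proof -
    have "piece_verts ps1 \<inter> (forest_verts rest - set b') = {}" using sub(1) dec(3) by blast
    then have "piece_verts ps1 \<inter> (set r \<union> piece_verts ps2) = {}"
      unfolding rest using sets(1) c(3) by blast
    moreover have "piece_verts ps' \<inter> (set r \<union> piece_verts ps2) = {}"
      unfolding rest using sets(1,2) c_rest by blast
    moreover have "piece_verts ps1 \<inter> piece_verts ps' = {}" using sets c by auto
    ultimately show ?thesis
      using rest(2) sub(2) sets(3) eqs(5) by (auto simp: set_concat_pieces simp del: set_concat)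
  qed
  ultimately show ?case by blast
qed

text \<open>\<open>D\<close> holds the vertices cut off earlier. Neighbours in \<open>D\<close> are
  unrestricted since such an edge has been accounted for by the bag of the earlier piece.\<close>

fun separated :: "('a \<Rightarrow> 'a set) \<Rightarrow> 'a set \<Rightarrow> ('a list \<times> 'a list) list \<Rightarrow> bool" where
  "separated N D [] \<longleftrightarrow> True"
| "separated N D ((b, p) # ps) \<longleftrightarrow>
     (\<forall>v\<in>set p. N v \<subseteq> set b \<union> set p \<union> D) \<and> separated N (D \<union> set p) ps"

lemma separated_append:
  "separated N D (ps @ qs) \<longleftrightarrow> separated N D ps \<and> separated N (D \<union> piece_verts ps) qs"
  by (induction N D ps rule: separated.induct) (auto simp: Un_assoc)

text \<open>The second conjunct is the invariant: an uncut vertex sees only the current bag, other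
  uncut vertices and finished pieces. When the uncut vertices become a piece, this is the condition
  required of it.\<close>

lemma pieces_separated:
  assumes "decomposes N b' ts" "pieces u b' ts acc = (r, ps)"
    and "\<forall>v\<in>set acc. N v \<subseteq> set b' \<union> set acc \<union> D"
  shows "separated N D ps \<and> (\<forall>v\<in>set r. N v \<subseteq> set b' \<union> set r \<union> (D \<union> piece_verts ps))"
  using assms
proof (induction u b' ts acc arbitrary: r ps D rule: pieces.induct)
  case (1 u b' acc)
  then show ?case by simp
next
  case (2 u b' b ts rest acc)
  from \<open>pieces u b' (Node b ts # rest) acc = (r, ps)\<close>
  obtain a ps1 c d ps' ps2 where eqs:
    "pieces u b ts [] = (a, ps1)" "c = filter (\<lambda>x. x \<notin> set b') b @ rev a @ acc"
    "length c \<le> length b' * u \<and> d = c \<and> ps' = [] \<or>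
     length c > length b' * u \<and> d = [] \<and> ps' = [(b', c)]"
    "pieces u b' rest d = (r, ps2)" "ps = ps1 @ ps' @ ps2"
    by (rule pieces_NodeE)
  have dec: "\<forall>v\<in>set b - set b'. N v \<subseteq> set b \<union> forest_verts ts"
    "decomposes N b ts" "decomposes N b' rest"
    using "2.prems"(1) by simp_all
  let ?D1 = "D \<union> piece_verts ps1"
  have sub: "separated N D ps1" "\<forall>v\<in>set a. N v \<subseteq> set b \<union> set a \<union> ?D1"
    using "2.IH"(1)[OF dec(2) eqs(1), of D] by auto
  \<comment> \<open>Every vertex below is in \<open>b\<close>, still collected, or already cut; the
    vertices of \<open>b\<close> in turn are in \<open>b'\<close> or in \<open>c\<close>. This
    covers all neighbours of the vertices in \<open>b\<close> outside \<open>b'\<close>.\<close>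
  have "forest_verts ts \<subseteq> set b \<union> set a \<union> piece_verts ps1"
    using pieces_partition[OF dec(2) eqs(1)] by auto
  then have c: "\<forall>v\<in>set c. N v \<subseteq> set b' \<union> set c \<union> ?D1"
    using sub(2) dec(1) "2.prems"(3) unfolding eqs(2) by fastforce
  have d_eq: "d = (if length c \<le> length b' * u then c else [])" using eqs(3) by auto
  have "\<forall>v\<in>set d. N v \<subseteq> set b' \<union> set d \<union> (?D1 \<union> piece_verts ps')"
    using eqs(3) c by auto
  then have rest: "separated N (?D1 \<union> piece_verts ps') ps2"
    "\<forall>v\<in>set r. N v \<subseteq> set b' \<union> set r \<union> (?D1 \<union> piece_verts ps' \<union> piece_verts ps2)"
    using "2.IH"(2)[OF eqs(1)[symmetric] refl eqs(2) dec(3), of r ps2 "?D1 \<union> piece_verts ps'"]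
      eqs(4) d_eq by auto
  have "separated N ?D1 ps'" using eqs(3) c by auto
  then show ?case
    using sub rest eqs(5) by (auto simp: separated_append Un_assoc)
qed

text \<open>What is compared with the cut-off consists of at most \<open>w\<close> new vertices of
  the child's bag, the remainder of the child and that of the earlier siblings. Both remainders
  passed the test before, so each has at most \<open>w * u\<close> vertices.\<close>

lemma pieces_length:
  assumes "pieces u b' ts acc = (r, ps)" "\<forall>t\<in>set ts. \<forall>b\<in>set_rtree t. length b \<le> w"
    and "length b' \<le> w" "length acc \<le> length b' * u"
  shows "length r \<le> length b' * u \<and>
    (\<forall>(b, p)\<in>set ps. length b * u < length p \<and> length p \<le> w + 2 * (w * u))"
  using assms
proof (induction u b' ts acc arbitrary: r ps rule: pieces.induct)
  case (1 u b' acc)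
  then show ?case by simp
next
  case (2 u b' b ts rest acc)
  from \<open>pieces u b' (Node b ts # rest) acc = (r, ps)\<close>
  obtain a ps1 c d ps' ps2 where eqs:
    "pieces u b ts [] = (a, ps1)" "c = filter (\<lambda>x. x \<notin> set b') b @ rev a @ acc"
    "length c \<le> length b' * u \<and> d = c \<and> ps' = [] \<or>
     length c > length b' * u \<and> d = [] \<and> ps' = [(b', c)]"
    "pieces u b' rest d = (r, ps2)" "ps = ps1 @ ps' @ ps2"
    by (rule pieces_NodeE)
  have w: "\<forall>t\<in>set ts. \<forall>b\<in>set_rtree t. length b \<le> w" "length b \<le> w"
    "\<forall>t\<in>set rest. \<forall>b\<in>set_rtree t. length b \<le> w"
    using "2.prems"(2) by auto
  have sub: "length a \<le> length b * u"
    "\<forall>(b, p)\<in>set ps1. length b * u < length p \<and> length p \<le> w + 2 * (w * u)"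
    using "2.IH"(1)[OF eqs(1) w(1,2)] by auto
  have d_eq: "d = (if length c \<le> length b' * u then c else [])" using eqs(3) by auto
  have rest: "length r \<le> length b' * u"
    "\<forall>(b, p)\<in>set ps2. length b * u < length p \<and> length p \<le> w + 2 * (w * u)"
    using "2.IH"(2)[OF eqs(1)[symmetric] refl eqs(2) _ w(3) "2.prems"(3), of r ps2] eqs(4) d_eq
    by auto
  have "length c \<le> length b + length a + length acc"
    unfolding eqs(2) by simp
  moreover have "length b * u \<le> w * u" "length b' * u \<le> w * u"
    using w "2.prems"(3) by auto
  ultimately have "length c \<le> w + 2 * (w * u)"
    using w(2) sub(1) "2.prems"(4) by linarith
  then show ?case using sub(2) rest eqs(3,5) by auto
qed

section \<open>Addresses in rooted trees and bags at the border of a subtree\<close>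

lemma subtree_append: "subtree t (p @ q) = subtree (subtree t p) q"
  by (induction t p rule: subtree.induct) auto

lemma is_pos_append: "is_pos t (p @ q) \<longleftrightarrow> is_pos t p \<and> is_pos (subtree t p) q"
  by (induction t p rule: subtree.induct) auto

lemma is_pos_map_rtree [simp]: "is_pos (map_rtree f t) p \<longleftrightarrow> is_pos t p"
  by (induction t p rule: is_pos.induct) (auto simp: rtree.map_sel)

lemma label_subtree_map_rtree:
  "is_pos t p \<Longrightarrow> label (subtree (map_rtree f t) p) = f (label (subtree t p))"
  by (induction t p rule: is_pos.induct) (auto simp: rtree.map_sel)

lemma set_rtree_iff: "b \<in> set_rtree t \<longleftrightarrow> (\<exists>q. is_pos t q \<and> label (subtree t q) = b)"
proof (induction t)
  case (Node b' ts)
  have "(\<exists>t\<in>set ts. b \<in> set_rtree t) \<longleftrightarrow>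
      (\<exists>i q. i < length ts \<and> is_pos (ts ! i) q \<and> label (subtree (ts ! i) q) = b)"
    using Node by (metis in_set_conv_nth)
  moreover have "(\<exists>q. is_pos (Node b' ts) q \<and> label (subtree (Node b' ts) q) = b) \<longleftrightarrow> b = b' \<or>
      (\<exists>i q. i < length ts \<and> is_pos (ts ! i) q \<and> label (subtree (ts ! i) q) = b)"
    (is "?L \<longleftrightarrow> ?R")
  proof
    assume ?L
    then obtain q where "is_pos (Node b' ts) q" "label (subtree (Node b' ts) q) = b" by blast
    then show ?R by (cases q) auto
  next
    assume R: ?R
    show ?L
    proof (cases "b = b'")
      case True
      then show ?thesis by (intro exI[of _ "[]"]) simp
    next
      case False
      with R obtain i q where "i < length ts" "is_pos (ts ! i) q" "label (subtree (ts ! i) q) = b"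
        by blast
      then show ?thesis by (intro exI[of _ "i # q"]) simp
    qed
  qed
  ultimately show ?case by auto
qed

lemma mem_tree_verts:
  "v \<in> tree_verts (subtree t p) \<and> is_pos t p \<longleftrightarrow>
     (\<exists>q. is_pos t (p @ q) \<and> v \<in> set (label (subtree t (p @ q))))"
  by (auto simp: tree_verts_def Bex_def set_rtree_iff is_pos_append subtree_append)

text \<open>The only edge leaving the subtree at \<open>r\<close> joins \<open>r\<close> to its parent \<open>butlast r\<close>.\<close>

lemma walk_leaves_subtree:
  assumes "walk (induced (graph_of T) S) xs" "\<exists>q. hd xs = r @ q" "\<nexists>q. last xs = r @ q"
  shows "r \<in> S \<and> butlast r \<in> S"
  using assms
proof (induction xs rule: induct_list012)
  case (3 x y zs)
  have xy: "{x, y} \<in> edges (graph_of T)" "x \<in> S" "y \<in> S"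
    and walk: "walk (induced (graph_of T) S) (y # zs)"
    using 3(3) by (auto simp: walk_def induced_def)
  show ?case
  proof (cases "\<exists>q. y = r @ q")
    case True
    then show ?thesis using 3(2)[OF walk] 3(5) by simp
  next
    case False
    obtain q where q: "x = r @ q" using 3(4) by auto
    obtain p i where "{x, y} = {p, p @ [i]}" using xy(1) by (auto simp: graph_of_def)
    then have "x = p \<and> y = p @ [i] \<or> x = p @ [i] \<and> y = p" by (auto simp: doubleton_eq_iff)
    then have "x = p @ [i]" "y = p" using False q by auto
    moreover from this have "q = []" using False q by (cases q rule: rev_cases) auto
    ultimately show ?thesis using xy q by auto
  qed
qed (auto simp: walk_def)

text \<open>The nodes whose bags contain \<open>v\<close> are connected, so a walk among them from
  inside the subtree at \<open>r\<close> to \<open>y\<close> uses the edge between \<open>r\<close>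
  and its parent.\<close>

lemma tree_decomposition_leaves_subtree:
  assumes "tree_decomposition G (graph_of T) (bag_at T)"
    and "is_pos T (r @ q)" "v \<in> bag_at T (r @ q)" "is_pos T y" "v \<in> bag_at T y" "\<nexists>q. y = r @ q"
  shows "v \<in> bag_at T r \<and> v \<in> bag_at T (butlast r)"
proof -
  have "v \<in> verts G" using assms(1,4,5) by (auto simp: tree_decomposition_def graph_of_def)
  then have "connected_graph (induced (graph_of T) {t. v \<in> bag_at T t})"
    using assms(1) by (simp add: tree_decomposition_def)
  moreover have "r @ q \<in> verts (induced (graph_of T) {t. v \<in> bag_at T t})"
    "y \<in> verts (induced (graph_of T) {t. v \<in> bag_at T t})"
    using assms by (auto simp: induced_def graph_of_def)
  ultimately obtain xs where "walk (induced (graph_of T) {t. v \<in> bag_at T t}) xs"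
    "hd xs = r @ q" "last xs = y"
    unfolding connected_graph_def by blast
  then show ?thesis using walk_leaves_subtree[of T _ xs r] assms(6) by auto
qed

text \<open>All local conditions come from one principle: a vertex occurring both inside and outside
  the subtree of a child lies in the bags of the child and of its parent.\<close>

lemma tree_decomposition_decomposes:
  fixes t :: "nat list rtree"
  assumes td: "tree_decomposition G (graph_of (map_rtree set t)) (bag_at (map_rtree set t))"
    and dist: "\<forall>b\<in>set_rtree t. distinct b"
  shows "decomposes (\<lambda>v. {w. {v, w} \<in> edges G}) [] [t] \<and> tree_verts t = verts G"
proof -
  define N where "N v = {w. {v, w} \<in> edges G}" for v
  define B where "B p = set (label (subtree t p))" for p
  have bag: "bag_at (map_rtree set t) p = B p" if "is_pos t p" for p
    using that by (simp add: bag_at_def label_subtree_map_rtree B_def)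
  have leave: "v \<in> B r \<and> v \<in> B (butlast r)"
    if "is_pos t (r @ q)" "v \<in> B (r @ q)" "is_pos t y" "v \<in> B y" "\<nexists>q. y = r @ q" for v r q y
  proof -
    have "is_pos t r" using that(1) by (simp add: is_pos_append)
    moreover have "is_pos t (butlast r)"
      using \<open>is_pos t r\<close> by (cases r rule: rev_cases) (auto simp: is_pos_append)
    ultimately show ?thesis
      using tree_decomposition_leaves_subtree[OF td, of r q v y] that by (simp add: bag)
  qed
  have edge: "\<exists>x. is_pos t x \<and> v \<in> B x \<and> w \<in> B x" if "w \<in> N v" for v w
  proof -
    have "{v, w} \<in> edges G" using that by (simp add: N_def)
    then obtain x where "x \<in> verts (graph_of (map_rtree set t))" "{v, w} \<subseteq> bag_at (map_rtree set t) x"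
      using td unfolding tree_decomposition_def by blast
    then show ?thesis using bag by (auto simp: graph_of_def)
  qed
  have tv: "v \<in> tree_verts (subtree t p) \<longleftrightarrow> (\<exists>q. is_pos t (p @ q) \<and> v \<in> B (p @ q))"
    if "is_pos t p" for v p
    using mem_tree_verts[of v t p] that by (auto simp: B_def)
  \<comment> \<open>Stated for the children from position \<open>j\<close> on, since
    \<open>decomposes\<close> recurses along siblings as well as downwards.\<close>
  have dec: "decomposes M b' ts"
    if "M = N" "is_pos t p" "b' = label (subtree t p)" "ts = drop j (children (subtree t p))" for M b' ts p j
    using that
  proof (induction M b' ts arbitrary: p j rule: decomposes.induct)
    case (1 M b')
    then show ?case by simp
  next
    case (2 M b' b ts rest)
    let ?r = "p @ [j]"
    have j: "j < length (children (subtree t p))" using 2(6) by (metis drop_all leI list.distinct(1))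
    have sub: "subtree t ?r = Node b ts"
      using 2(6) j by (simp add: subtree_append Cons_nth_drop_Suc[symmetric, OF j])
    have pos: "is_pos t ?r" using 2(4) j by (simp add: is_pos_append)
    have rest: "rest = drop (Suc j) (children (subtree t p))"
      using 2(6) by (metis drop_Suc list.sel(3) tl_drop)
    have b': "set b' = B p" using 2(5) by (simp add: B_def)
    have b: "set b = B ?r" using sub by (simp add: B_def)
    have here: "v \<in> set b \<union> forest_verts ts \<longleftrightarrow> (\<exists>q. is_pos t (?r @ q) \<and> v \<in> B (?r @ q))" for v
      using tv[OF pos, of v] sub by simp
    have there: "\<exists>y. is_pos t y \<and> v \<in> B y \<and> (\<nexists>q. y = ?r @ q)" if v: "v \<in> forest_verts rest" for v
    proof -
      obtain s where s: "s \<in> set (drop (Suc j) (children (subtree t p)))" "v \<in> tree_verts s"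
        using v unfolding rest forest_verts_def by blast
      then obtain l where "l < length (drop (Suc j) (children (subtree t p)))"
        "drop (Suc j) (children (subtree t p)) ! l = s" by (metis in_set_conv_nth)
      then obtain i where i: "Suc j \<le> i" "i < length (children (subtree t p))"
        "v \<in> tree_verts (children (subtree t p) ! i)"
        using that[of "Suc j + l"] s(2) by simp
      have "is_pos t (p @ [i])" "subtree t (p @ [i]) = children (subtree t p) ! i"
        using 2(4) i by (auto simp: is_pos_append subtree_append)
      then obtain q where "is_pos t ((p @ [i]) @ q)" "v \<in> B ((p @ [i]) @ q)"
        using tv[of "p @ [i]" v] i(3) by auto
      moreover have "\<nexists>q'. (p @ [i]) @ q = ?r @ q'" using i by auto
      ultimately show ?thesis by blast
    qed
    have up: "v \<in> set b \<and> v \<in> set b'"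
      if "v \<in> set b \<union> forest_verts ts" "is_pos t y" "v \<in> B y" "\<nexists>q. y = ?r @ q" for v y
      using here[of v] that leave[of ?r _ v y] b b' by auto
    have "distinct b"
      using dist set_rtree_iff[of b t] pos sub by (metis rtree.sel(1))
    moreover have "set b' \<inter> forest_verts ts \<subseteq> set b"
      using up[of _ p] 2(4) b' by auto
    \<comment> \<open>An edge at \<open>v\<close> lies in some bag; as \<open>v\<close> is not in
      \<open>b'\<close>, all bags containing \<open>v\<close>, and so this one, are in the subtree
      at \<open>?r\<close>.\<close>
    moreover have "M v \<subseteq> set b \<union> forest_verts ts" if v: "v \<in> set b - set b'" for v
    proof
      fix w assume "w \<in> M v"
      then obtain x where x: "is_pos t x" "v \<in> B x" "w \<in> B x" using edge 2(3) by auto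
      then obtain q where "x = ?r @ q" using up[of v x] v by auto
      then show "w \<in> set b \<union> forest_verts ts" using here x by blast
    qed
    moreover have "(set b \<union> forest_verts ts) \<inter> forest_verts rest \<subseteq> set b'"
      using up there by blast
    moreover have "decomposes M b ts"
      by (rule 2(1)[OF 2(3) pos, of 0]) (simp_all add: sub)
    moreover have "decomposes M b' rest"
      by (rule 2(2)[OF 2(3-5) rest])
    ultimately show ?case by simp
  qed
  have verts: "tree_verts t = verts G"
  proof -
    have "tree_verts t = (\<Union>p\<in>{p. is_pos t p}. B p)" using tv[of "[]"] by auto
    also have "\<dots> = (\<Union>p\<in>{p. is_pos t p}. bag_at (map_rtree set t) p)" using bag by auto
    finally show ?thesis using td by (simp add: tree_decomposition_def graph_of_def)
  qed
  obtain b ts where t: "t = Node b ts" by (cases t)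
  have "N v \<subseteq> tree_verts t" for v
    using edge tv[of "[]"] by fastforce
  moreover have "decomposes N b ts" by (rule dec[where p = "[]" and j = 0]) (simp_all add: t)
  moreover have "distinct b" using dist t by simp
  ultimately have "decomposes N [] [t]" using t by simp
  then show ?thesis using verts by (simp add: N_def[abs_def])
qed

section \<open>Approximation guarantee\<close>

text \<open>\<open>induced\<close> returns a plain graph and would lose the capacities.\<close>

definition cinduced :: "'a cgraph \<Rightarrow> 'a set \<Rightarrow> 'a cgraph" where
  "cinduced G S = \<lparr>verts = verts G \<inter> S, edges = {e \<in> edges G. e \<subseteq> S}, cap = cap G\<rparr>"

lemma cinduced_simps [simp]:
  "verts (cinduced G S) = verts G \<inter> S" "edges (cinduced G S) = {e \<in> edges G. e \<subseteq> S}"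
  "cap (cinduced G S) = cap G"
  by (simp_all add: cinduced_def)

lemma simple_graph_cinduced: "simple_graph G \<Longrightarrow> simple_graph (cinduced G S)"
  by (auto simp: simple_graph_def)

lemma cap_dom_set_verts: "cap_dom_set G (verts G) f"
  by (simp add: cap_dom_set_def)

lemma cds_opt_le: "cap_dom_set G X f \<Longrightarrow> cds_opt G \<le> card X"
  unfolding cds_opt_def by (intro Least_le) blast

lemma cds_opt_attained:
  obtains X f where "cap_dom_set G X f" "card X = cds_opt G"
proof -
  have "\<exists>X f. cap_dom_set G X f \<and> card X = cds_opt G"
    unfolding cds_opt_def by (rule LeastI_ex) (use cap_dom_set_verts in blast)
  then show thesis using that by blast
qed

lemma finite_neighbours:
  assumes "simple_graph G" shows "finite {u. {v, u} \<in> edges G}"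
  by (rule finite_subset[of _ "verts G"]) (use assms in \<open>auto simp: simple_graph_def\<close>)

lemma degree_le_max_degree:
  assumes "simple_graph G" shows "card {u. {v, u} \<in> edges G} \<le> max_degree G"
proof (cases "v \<in> verts G")
  case True
  have "degree_of G v \<le> max_degree G"
    unfolding max_degree_def using assms True by (intro Max_ge) (auto simp: simple_graph_def)
  then show ?thesis by (simp add: degree_of_def)
next
  case False
  then have "{u. {v, u} \<in> edges G} = {}" using assms by (auto simp: simple_graph_def)
  then show ?thesis by simp
qed

lemma card_closed_neighbourhood:
  assumes "simple_graph G" "finite A"
  shows "card (\<Union>x\<in>A. insert x {u. {x, u} \<in> edges G}) \<le> card A * (max_degree G + 1)"
proof -
  have "card (\<Union>x\<in>A. insert x {u. {x, u} \<in> edges G}) \<le>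
      (\<Sum>x\<in>A. card (insert x {u. {x, u} \<in> edges G}))"
    using assms by (intro card_UN_le)
  also have "\<dots> \<le> (\<Sum>x\<in>A. max_degree G + 1)"
  proof (rule sum_mono)
    fix x
    show "card (insert x {u. {x, u} \<in> edges G}) \<le> max_degree G + 1"
      using degree_le_max_degree[OF assms(1), of x] finite_neighbours[OF assms(1), of x]
      by (simp add: card_insert_if)
  qed
  finally show ?thesis by simp
qed

text \<open>The lower bound on the optimum: a solution dominates everything through closed
  neighbourhoods, so a loss that is small against |V| is small against the optimum.\<close>

lemma card_verts_le:
  assumes "simple_graph G" "cap_dom_set G X f"
  shows "card (verts G) \<le> card X * (max_degree G + 1)"
proof -
  have fin: "finite X" using assms finite_subset by (auto simp: simple_graph_def cap_dom_set_def)
  have "verts G \<subseteq> (\<Union>x\<in>X. insert x {u. {x, u} \<in> edges G})"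
  proof
    fix v assume v: "v \<in> verts G"
    show "v \<in> (\<Union>x\<in>X. insert x {u. {x, u} \<in> edges G})"
    proof (cases "v \<in> X")
      case False
      then have "f v \<in> X" "{f v, v} \<in> edges G"
        using v assms(2) by (auto simp: cap_dom_set_def insert_commute)
      then show ?thesis by blast
    qed blast
  qed
  then have "card (verts G) \<le> card (\<Union>x\<in>X. insert x {u. {x, u} \<in> edges G})"
    using fin finite_neighbours[OF assms(1)] by (intro card_mono) auto
  then show ?thesis using card_closed_neighbourhood[OF assms(1) fin] by linarith
qed

text \<open>Vertices dominated from outside \<open>S\<close> join the solution. They carry no load,
  because \<open>f\<close> still maps into \<open>X\<close>, and the load of the vertices of
  \<open>X\<close> can only drop; so even capacity 0 suffices for the new ones.\<close>

lemma cap_dom_set_restrict: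
  assumes "simple_graph G" "cap_dom_set G X f" "S \<subseteq> verts G"
  shows "cap_dom_set (cinduced G S) ((X \<inter> S) \<union> {v \<in> S - X. f v \<notin> S}) f"
proof -
  let ?Y = "(X \<inter> S) \<union> {v \<in> S - X. f v \<notin> S}"
  have "card {v \<in> S - ?Y. f v = x} \<le> cap G x" if "x \<in> ?Y" for x
  proof (cases "x \<in> X")
    case True
    have "card {v \<in> S - ?Y. f v = x} \<le> card {v \<in> verts G - X. f v = x}"
      using assms by (intro card_mono) (auto simp: simple_graph_def)
    also have "\<dots> \<le> cap G x" using assms(2) True unfolding cap_dom_set_def by blast
    finally show ?thesis .
  next
    case False
    then have empty: "{v \<in> S - ?Y. f v = x} = {}"
      using assms(2,3) that by (auto simp: cap_dom_set_def)
    show ?thesis unfolding empty by simp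
  qed
  then show ?thesis
    using assms(2,3) unfolding cap_dom_set_def
    by (simp add: Int_absorb1) blast
qed

lemma distinct_concat_unique:
  "distinct (concat qs) \<Longrightarrow> q \<in> set qs \<Longrightarrow> q' \<in> set qs \<Longrightarrow> v \<in> set q \<Longrightarrow> v \<in> set q' \<Longrightarrow> q = q'"
  by (induction qs) auto

text \<open>Dominators are in the same piece as what they dominate and the pieces are disjoint, so
  the load of a vertex comes from its own piece alone.\<close>

lemma cap_dom_set_Union:
  assumes "simple_graph G" "distinct (concat qs)" "set (concat qs) = verts G"
    and dom: "\<And>q. q \<in> set qs \<Longrightarrow> cap_dom_set (cinduced G (set q)) (X q) f"
  shows "cap_dom_set G (\<Union>q\<in>set qs. X q) f"
proof -
  have X: "X q \<subseteq> set q" if "q \<in> set qs" for q using dom[OF that] by (auto simp: cap_dom_set_def)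
  have f: "f v \<in> X q \<and> {v, f v} \<in> edges G" if "q \<in> set qs" "v \<in> set q - X q" for q v
    using dom[OF that(1)] assms(3) that by (auto simp: cap_dom_set_def)
  have "card {v \<in> verts G - (\<Union>q\<in>set qs. X q). f v = x} \<le> cap G x"
    if "q \<in> set qs" "x \<in> X q" for x q
  proof -
    have "{v \<in> verts G - (\<Union>q\<in>set qs. X q). f v = x} \<subseteq> {v \<in> verts G \<inter> set q - X q. f v = x}"
    proof
      fix v assume v: "v \<in> {v \<in> verts G - (\<Union>q\<in>set qs. X q). f v = x}"
      then obtain q' where q': "q' \<in> set qs" "v \<in> set q' - X q'" using assms(3) by auto
      then have "x \<in> set q'" using f v X by blast
      then have "q' = q" using distinct_concat_unique[OF assms(2)] q' that X by blast
      then show "v \<in> {v \<in> verts G \<inter> set q - X q. f v = x}" using v q' by auto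
    qed
    then have "card {v \<in> verts G - (\<Union>q\<in>set qs. X q). f v = x} \<le>
        card {v \<in> verts G \<inter> set q - X q. f v = x}"
      by (intro card_mono) auto
    also have "\<dots> \<le> cap G x"
      using dom[OF that(1)] that(2) unfolding cap_dom_set_def cinduced_simps by blast
    finally show ?thesis .
  qed
  moreover have "(\<Union>q\<in>set qs. X q) \<subseteq> verts G" using X assms(3) by auto
  moreover have "\<forall>v\<in>verts G - (\<Union>q\<in>set qs. X q). f v \<in> (\<Union>q\<in>set qs. X q) \<and> {v, f v} \<in> edges G"
  proof
    fix v assume v: "v \<in> verts G - (\<Union>q\<in>set qs. X q)"
    then obtain q where "q \<in> set qs" "v \<in> set q" using assms(3) by auto
    then show "f v \<in> (\<Union>q\<in>set qs. X q) \<and> {v, f v} \<in> edges G" using f[of q v] v by blast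
  qed
  ultimately show ?thesis unfolding cap_dom_set_def by blast
qed

lemma sum_list_card_pieces:
  assumes "distinct (concat qs)"
  shows "(\<Sum>q\<leftarrow>qs. card {v \<in> set q. P q v}) = card {v. \<exists>q\<in>set qs. v \<in> set q \<and> P q v}"
  using assms
proof (induction qs)
  case (Cons q qs)
  have "{v. \<exists>q'\<in>set (q # qs). v \<in> set q' \<and> P q' v} =
    {v \<in> set q. P q v} \<union> {v. \<exists>q\<in>set qs. v \<in> set q \<and> P q v}" by auto
  moreover have "finite {v. \<exists>q\<in>set qs. v \<in> set q \<and> P q v}"
    by (rule finite_subset[of _ "set (concat qs)"]) auto
  moreover have "{v \<in> set q. P q v} \<inter> {v. \<exists>q\<in>set qs. v \<in> set q \<and> P q v} = {}"
    using Cons.prems by auto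
  ultimately show ?case using Cons by (simp add: card_Un_disjoint)
qed simp

text \<open>Restrict the one solution \<open>X\<close> to every piece: over all pieces,
  \<open>X\<close> is counted once, and the only extra cost is the vertices dominated across
  pieces.\<close>

lemma sum_cds_opt_pieces_le:
  assumes "simple_graph G" "distinct (concat qs)" "set (concat qs) = verts G" "cap_dom_set G X f"
  shows "(\<Sum>q\<leftarrow>qs. cds_opt (cinduced G (set q))) \<le>
    card X + card {v \<in> verts G - X. \<forall>q\<in>set qs. v \<in> set q \<longrightarrow> f v \<notin> set q}"
proof -
  have "cds_opt (cinduced G (set q)) \<le>
      card {v \<in> set q. v \<in> X} + card {v \<in> set q. v \<notin> X \<and> f v \<notin> set q}" if "q \<in> set qs" for q
  proof -
    have "set q \<subseteq> verts G" using assms(3) that by auto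
    from cds_opt_le[OF cap_dom_set_restrict[OF assms(1,4) this]]
    have "cds_opt (cinduced G (set q)) \<le> card ((X \<inter> set q) \<union> {v \<in> set q - X. f v \<notin> set q})" .
    also have "\<dots> \<le> card (X \<inter> set q) + card {v \<in> set q - X. f v \<notin> set q}" by (rule card_Un_le)
    also have "X \<inter> set q = {v \<in> set q. v \<in> X}" by auto
    also have "{v \<in> set q - X. f v \<notin> set q} = {v \<in> set q. v \<notin> X \<and> f v \<notin> set q}" by auto
    finally show ?thesis .
  qed
  then have "(\<Sum>q\<leftarrow>qs. cds_opt (cinduced G (set q))) \<le>
      (\<Sum>q\<leftarrow>qs. card {v \<in> set q. v \<in> X} + card {v \<in> set q. v \<notin> X \<and> f v \<notin> set q})"
    by (rule sum_list_mono)
  also have "\<dots> = card {v. \<exists>q\<in>set qs. v \<in> set q \<and> v \<in> X} +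
      card {v. \<exists>q\<in>set qs. v \<in> set q \<and> v \<notin> X \<and> f v \<notin> set q}"
    by (simp add: sum_list_addf sum_list_card_pieces[OF assms(2)])
  also have "{v. \<exists>q\<in>set qs. v \<in> set q \<and> v \<in> X} = X"
    using assms(3,4) by (auto simp: cap_dom_set_def)
  also have "{v. \<exists>q\<in>set qs. v \<in> set q \<and> v \<notin> X \<and> f v \<notin> set q} =
      {v \<in> verts G - X. \<forall>q\<in>set qs. v \<in> set q \<longrightarrow> f v \<notin> set q}"
  proof -
    \<comment> \<open>Each vertex is in exactly one piece, so the existential and the universal form
      agree.\<close>
    have "(\<exists>q\<in>set qs. v \<in> set q \<and> f v \<notin> set q) \<longleftrightarrow>
        v \<in> verts G \<and> (\<forall>q\<in>set qs. v \<in> set q \<longrightarrow> f v \<notin> set q)" for v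
    proof -
      have "v \<in> verts G \<longleftrightarrow> (\<exists>q\<in>set qs. v \<in> set q)" using assms(3) by auto
      then show ?thesis using distinct_concat_unique[OF assms(2), of _ _ v] by metis
    qed
    then show ?thesis by blast
  qed
  finally show ?thesis .
qed

text \<open>Look at whichever of the two pieces was cut first: the edge leaves it for a later piece,
  so its other end is in the bag of that cut. Either end may belong to the earlier piece, hence the
  disjunction.\<close>

lemma separated_crossing:
  assumes "separated N D ps" "distinct (concat (map snd ps))" "D \<inter> piece_verts ps = {}"
    and "v \<in> piece_verts ps" "w \<in> piece_verts ps" "w \<in> N v" "v \<in> N w"
    and "\<forall>p\<in>set ps. v \<in> set (snd p) \<longrightarrow> w \<notin> set (snd p)"
  shows "\<exists>p\<in>set ps. v \<in> set (fst p) \<or> w \<in> set (fst p)"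
  using assms
proof (induction N D ps rule: separated.induct)
  case (2 N D b p ps)
  have D: "v \<notin> D" "w \<notin> D" using 2 by auto
  consider "v \<in> set p" | "w \<in> set p" | "v \<in> piece_verts ps" "w \<in> piece_verts ps" using 2 by auto
  then show ?case
  proof cases
    case 1
    then show ?thesis using 2 D by auto
  next
    case 2
    then show ?thesis using "2.prems" D by auto
  next
    case 3
    have "(D \<union> set p) \<inter> piece_verts ps = {}"
      using "2.prems"(2,3) by (auto simp: set_concat_pieces simp del: set_concat)
    then show ?thesis using 2 3 by auto
  qed
qed simp

text \<open>The ratio 1 + 1/k, multiplied out to stay within the natural numbers.\<close>

lemma sum_cds_opt_separated_le:
  fixes G :: "'a cgraph"
  defines "N \<equiv> \<lambda>v. {w. {v, w} \<in> edges G}"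
  assumes G: "simple_graph G" and sep: "separated N {} ps"
    and dist: "distinct (concat (map snd ps))" and verts: "piece_verts ps = verts G"
    and large: "\<forall>(b, p)\<in>set ps. length b * (k * (max_degree G + 1)^2) \<le> length p"
  shows "k * (\<Sum>p\<leftarrow>map snd ps. cds_opt (cinduced G (set p))) \<le> (k + 1) * cds_opt G"
proof -
  let ?\<Delta> = "max_degree G"
  obtain X f where X: "cap_dom_set G X f" "card X = cds_opt G" by (rule cds_opt_attained)
  define Z where "Z = {v \<in> verts G - X. \<forall>q\<in>set (map snd ps). v \<in> set q \<longrightarrow> f v \<notin> set q}"
  let ?B = "\<Union>p\<in>set ps. set (fst p)"
  have "Z \<subseteq> (\<Union>x\<in>?B. insert x {u. {x, u} \<in> edges G})"
  proof
    fix v assume v: "v \<in> Z"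
    then have f: "f v \<in> verts G" "f v \<in> N v" "v \<in> N (f v)"
      using X(1) by (auto simp: Z_def cap_dom_set_def N_def insert_commute)
    \<comment> \<open>If it is \<open>f v\<close> that lies in a cutting bag, \<open>v\<close> is
      still one of its neighbours.\<close>
    have "\<exists>p\<in>set ps. v \<in> set (fst p) \<or> f v \<in> set (fst p)"
      by (rule separated_crossing[OF sep dist]) (use v f verts in \<open>auto simp: Z_def\<close>)
    then show "v \<in> (\<Union>x\<in>?B. insert x {u. {x, u} \<in> edges G})" using f(3) by (auto simp: N_def)
  qed
  then have "card Z \<le> card (\<Union>x\<in>?B. insert x {u. {x, u} \<in> edges G})"
    by (intro card_mono) (auto simp: finite_neighbours[OF G])
  also have "\<dots> \<le> card ?B * (?\<Delta> + 1)" by (rule card_closed_neighbourhood[OF G]) simp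
  finally have Z: "card Z \<le> card ?B * (?\<Delta> + 1)" .
  have "card ?B = card (set (concat (map fst ps)))" by simp
  also have "\<dots> \<le> (\<Sum>p\<leftarrow>ps. length (fst p))"
    by (rule order_trans[OF card_length]) (simp add: length_concat o_def)
  finally have B: "card ?B \<le> (\<Sum>p\<leftarrow>ps. length (fst p))" .
  have "card ?B * (k * (?\<Delta> + 1)^2) \<le> (\<Sum>p\<leftarrow>ps. length (fst p)) * (k * (?\<Delta> + 1)^2)"
    using B by (rule mult_le_mono1)
  also have "\<dots> = (\<Sum>p\<leftarrow>ps. length (fst p) * (k * (?\<Delta> + 1)^2))"
    by (simp add: sum_list_mult_const)
  also have "\<dots> \<le> (\<Sum>p\<leftarrow>ps. length (snd p))"
    using large by (intro sum_list_mono) auto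
  also have "\<dots> = length (concat (map snd ps))" by (simp add: length_concat o_def)
  also have "\<dots> = card (verts G)"
    using distinct_card[OF dist] verts set_concat_pieces[of ps] by metis
  also have "\<dots> \<le> card X * (?\<Delta> + 1)" by (rule card_verts_le[OF G X(1)])
  \<comment> \<open>One factor \<Delta> + 1 cancels against the lower bound on
    \<open>card X\<close>; the other remains for the neighbourhoods that contain
    \<open>Z\<close>.\<close>
  finally have "(card ?B * (k * (?\<Delta> + 1))) * (?\<Delta> + 1) \<le> card X * (?\<Delta> + 1)"
    by (simp only: power2_eq_square mult.assoc)
  then have "card ?B * (k * (?\<Delta> + 1)) \<le> card X"
    by (rule mult_right_le_imp_le) simp
  moreover have "k * card Z \<le> k * (card ?B * (?\<Delta> + 1))" using Z by (rule mult_le_mono2)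
  ultimately have "k * card Z \<le> card X" by (simp only: mult.left_commute)
  moreover have "(\<Sum>p\<leftarrow>map snd ps. cds_opt (cinduced G (set p))) \<le> card X + card Z"
    unfolding Z_def
    by (rule sum_cds_opt_pieces_le[OF G dist _ X(1)]) (use verts in \<open>simp only: set_concat_pieces\<close>)
  then have "k * (\<Sum>p\<leftarrow>map snd ps. cds_opt (cinduced G (set p))) \<le> k * (card X + card Z)"
    by (rule mult_le_mono2)
  ultimately show ?thesis using X(2) by (simp add: algebra_simps)
qed

section \<open>Correctness of degrees and induced subgraphs on encodings\<close>

lemma length_incident:
  assumes G: "simple_graph G" and es: "distinct (map (\<lambda>(u, v). {u, v}) es)"
    "set (map (\<lambda>(u, v). {u, v}) es) = edges G"
  shows "length (incident v es) = degree_of G v"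
proof -
  let ?h = "\<lambda>(u, v). {u, v}"
  have "distinct (map ?h (incident v es))"
    using es(1) unfolding incident_def by (rule distinct_map_filter)
  then have "length (incident v es) = card (?h ` set (incident v es))"
    using distinct_card by fastforce
  also have "?h ` set (incident v es) = {e \<in> edges G. v \<in> e}"
    unfolding es(2)[symmetric] incident_def by auto
  also have "card {e \<in> edges G. v \<in> e} = degree_of G v"
    unfolding degree_of_def
  proof (rule bij_betw_same_card[symmetric, of "\<lambda>u. {v, u}"], rule bij_betwI')
    fix e assume "e \<in> {e \<in> edges G. v \<in> e}"
    then have "e \<in> edges G" "v \<in> e" "card e = 2" using G by (auto simp: simple_graph_def)
    then obtain a b where "e = {a, b}" by (auto simp: card_2_iff)
    then show "\<exists>u\<in>{u. {v, u} \<in> edges G}. e = {v, u}"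
      using \<open>e \<in> edges G\<close> \<open>v \<in> e\<close> by (auto simp: insert_commute)
  qed (auto simp: doubleton_eq_iff)
  finally show ?thesis .
qed

lemma dfilter_map:
  "dfilter P (enc_list (map g xs)) = enc_list (map g (rev (filter (\<lambda>x. P (g x) \<noteq> Nl) xs)))"
  by (simp add: filter_map o_def rev_map)

lemma dinduced_encodes:
  assumes "distinct vs" "set vs = verts G"
    and "distinct (map (\<lambda>(u, v). {u, v}) es)" "set (map (\<lambda>(u, v). {u, v}) es) = edges G"
  shows "encodes_cgraph (dinduced (Pr (enc_list (map (\<lambda>v. enc_nat_pair (v, cap G v)) vs))
      (enc_list (map enc_nat_pair es))) (enc_list (map enc_nat p))) (cinduced G (set p))"
proof -
  let ?vs = "rev (filter (\<lambda>v. v \<in> set p) vs)"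
  let ?es = "rev (filter (\<lambda>e. fst e \<in> set p \<and> snd e \<in> set p) es)"
  have "distinct (map (\<lambda>(u, v). {u, v}) ?es)"
    using assms(3) by (simp add: rev_map[symmetric] distinct_map_filter)
  moreover have "set (map (\<lambda>(u, v). {u, v}) ?es) = edges (cinduced G (set p))"
    unfolding cinduced_simps assms(4)[symmetric] by (auto split: prod.splits)
  moreover have "distinct ?vs" "set ?vs = verts (cinduced G (set p))" using assms by auto
  moreover have "dinduced (Pr (enc_list (map (\<lambda>v. enc_nat_pair (v, cap G v)) vs))
      (enc_list (map enc_nat_pair es))) (enc_list (map enc_nat p)) =
    Pr (enc_list (map (\<lambda>v. enc_nat_pair (v, cap (cinduced G (set p)) v)) ?vs))
      (enc_list (map enc_nat_pair ?es))"
  proof -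
    have "(if dmember (enc_nat a) (enc_list (map enc_nat p)) = Nl then Nl
        else dmember (enc_nat b) (enc_list (map enc_nat p))) \<noteq> Nl \<longleftrightarrow> a \<in> set p \<and> b \<in> set p" for a b
      by simp
    then show ?thesis by (simp only: dinduced_def dfilter_map left.simps right.simps
          left_right_enc_nat_pair fst_conv snd_conv dmember_enc_nat not_not cinduced_simps)
  qed
  ultimately show ?thesis unfolding encodes_cgraph_def by blast
qed

section \<open>The oracle program\<close>

text \<open>The calculus of \<open>ptime\<close> covers programs without queries, so the code around
  the oracle calls uses fixed registers and explicit step counts.\<close>

definition move_com :: "nat \<Rightarrow> nat \<Rightarrow> com" where
  "move_com x y = While (Var x) (Seq (Assign y (EPr (ELeft (Var x)) (Var y))) (Assign x (ERight (Var x))))"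

lemma exec_move_com:
  assumes "x \<noteq> y" "s x = enc_list xs" "s y = enc_list ys"
  shows "exec ora (move_com x y) s (s(x := Nl, y := enc_list (rev xs @ ys))) (3 * length xs + 1) {}"
  using assms(2,3)
proof (induction xs arbitrary: s ys)
  case Nil
  then have eq: "s(x := Nl, y := enc_list (rev [] @ ys)) = s" by auto
  have "exec ora (move_com x y) s s 1 {}"
    unfolding move_com_def using Nil by (intro exec.WhileFalse) simp
  then show ?case unfolding eq by simp
next
  case (Cons a xs)
  let ?s = "s(y := Pr a (s y), x := enc_list xs)"
  let ?body = "Seq (Assign y (EPr (ELeft (Var x)) (Var y))) (Assign x (ERight (Var x)))"
  have "exec ora ?body s ?s (1 + 1) {}"
    by (rule exec_Seq[OF exec_Assign exec_Assign]) (use assms(1) Cons.prems in simp_all)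
  moreover have "exec ora (move_com x y) ?s (?s(x := Nl, y := enc_list (rev xs @ (a # ys)))) (3 * length xs + 1) {}"
    using assms(1) Cons.prems by (intro Cons.IH) simp_all
  ultimately have "exec ora (move_com x y) s (?s(x := Nl, y := enc_list (rev xs @ (a # ys))))
      ((1 + 1) + (3 * length xs + 1) + 1) ({} \<union> {})"
    unfolding move_com_def using Cons.prems by (intro exec.WhileTrue) simp_all
  moreover have "?s(x := Nl, y := enc_list (rev xs @ (a # ys))) = s(x := Nl, y := enc_list (rev (a # xs) @ ys))"
    using assms(1) by auto
  moreover have "(1 + 1) + (3 * length xs + 1) + 1 = 3 * length (a # xs) + 1" by simp
  ultimately show ?case by (simp only: Un_empty_left)
qed

text \<open>
  Asks all queries in the list in register \<open>2\<close> and collects the two components of the answers in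
  registers \<open>1\<close> and \<open>3\<close>.
\<close>

definition ask_com :: com where
  "ask_com = While (Var 2)
     (Seq (Query 4 (ELeft (Var 2))) (Seq (Assign 2 (ERight (Var 2)))
       (Seq (Assign 5 (ELeft (Var 4))) (Seq (move_com 5 1)
         (Seq (Assign 5 (ERight (Var 4))) (move_com 5 3))))))"

text \<open>The 7 steps per query are the loop test, the query, three assignments and the two
  failing tests that end the inner loops; each moved entry costs a test and two assignments.\<close>

lemma exec_ask_com:
  assumes "\<forall>p\<in>set ps. ora (q p) = Pr (enc_list (A p)) (enc_list (B p))"
    and "s 1 = enc_list as" "s 2 = enc_list (map q ps)" "s 3 = enc_list bs"
  shows "\<exists>s' n. exec ora ask_com s s' n (q ` set ps) \<and>
    s' 1 = enc_list (rev (concat (map A ps)) @ as) \<and> s' 3 = enc_list (rev (concat (map B ps)) @ bs) \<and>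
    n \<le> 1 + (\<Sum>p\<leftarrow>ps. 3 * (length (A p) + length (B p)) + 7)"
  using assms
proof (induction ps arbitrary: s as bs)
  case Nil
  then show ?case
    using exec.WhileFalse[of "Var 2" s ora] by (intro exI[of _ s] exI[of _ 1]) (simp add: ask_com_def)
next
  case (Cons p ps)
  let ?body = "Seq (Query 4 (ELeft (Var 2))) (Seq (Assign 2 (ERight (Var 2)))
       (Seq (Assign 5 (ELeft (Var 4))) (Seq (move_com 5 1)
         (Seq (Assign 5 (ERight (Var 4))) (move_com 5 3)))))"
  have ans: "ora (q p) = Pr (enc_list (A p)) (enc_list (B p))" using Cons.prems(1) by simp
  let ?s1 = "s(4 := ora (q p))"
  let ?s2 = "?s1(2 := enc_list (map q ps))"
  let ?s3 = "?s2(5 := enc_list (A p))"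
  let ?s4 = "?s3(5 := Nl, 1 := enc_list (rev (A p) @ as))"
  let ?s5 = "?s4(5 := enc_list (B p))"
  let ?s6 = "?s5(5 := Nl, 3 := enc_list (rev (B p) @ bs))"
  have "exec ora (Query 4 (ELeft (Var 2))) s ?s1 1 {q p}"
    using exec.Query[of ora 4 "ELeft (Var 2)" s] Cons.prems by simp
  moreover have "exec ora (Seq (Assign 2 (ERight (Var 2)))
       (Seq (Assign 5 (ELeft (Var 4))) (Seq (move_com 5 1)
         (Seq (Assign 5 (ERight (Var 4))) (move_com 5 3))))) ?s1 ?s6
       (1 + (1 + ((3 * length (A p) + 1) + (1 + (3 * length (B p) + 1))))) {}"
    by (rule exec_Seq[OF exec_Assign exec_Seq[OF exec_Assign exec_Seq[OF exec_move_com
            exec_Seq[OF exec_Assign exec_move_com]]]])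
      (use Cons.prems ans in simp_all)
  ultimately have "exec ora ?body s ?s6
      (1 + (1 + (1 + ((3 * length (A p) + 1) + (1 + (3 * length (B p) + 1)))))) ({q p} \<union> {})"
    by (rule exec.Seq)
  moreover obtain s' n where s': "exec ora ask_com ?s6 s' n (q ` set ps)"
    "s' 1 = enc_list (rev (concat (map A ps)) @ (rev (A p) @ as))"
    "s' 3 = enc_list (rev (concat (map B ps)) @ (rev (B p) @ bs))"
    "n \<le> 1 + (\<Sum>p\<leftarrow>ps. 3 * (length (A p) + length (B p)) + 7)"
  proof -
    have "\<exists>s' n. exec ora ask_com ?s6 s' n (q ` set ps) \<and>
      s' 1 = enc_list (rev (concat (map A ps)) @ (rev (A p) @ as)) \<and>
      s' 3 = enc_list (rev (concat (map B ps)) @ (rev (B p) @ bs)) \<and>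
      n \<le> 1 + (\<Sum>p\<leftarrow>ps. 3 * (length (A p) + length (B p)) + 7)"
      by (rule Cons.IH) (use Cons.prems in simp_all)
    then show thesis using that by blast
  qed
  ultimately have "exec ora ask_com s s'
      ((1 + (1 + (1 + ((3 * length (A p) + 1) + (1 + (3 * length (B p) + 1)))))) + n + 1)
      (({q p} \<union> {}) \<union> q ` set ps)"
    unfolding ask_com_def using Cons.prems(3) by (intro exec.WhileTrue) simp_all
  then show ?case using s'(2-4)
    by (intro exI[of _ s'] exI[of _ "(1 + (1 + (1 + ((3 * length (A p) + 1) +
        (1 + (3 * length (B p) + 1)))))) + n + 1"]) simp
qed

text \<open>Register 1 starts with the part of the solution decided by the plan. Register 3 has to
  be cleared because \<open>P\<close> may overwrite all registers above its own.\<close>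

definition kernelization_com :: "com \<Rightarrow> com" where
  "kernelization_com P = Seq P (Seq (Assign 1 (ELeft (Var 0))) (Seq (Assign 2 (ERight (Var 0)))
     (Seq (Assign 3 ENl) (Seq ask_com (Assign 0 (EPr (Var 1) (Var 3)))))))"

lemma exec_kernelization_com:
  assumes "implements P f T" and f: "f d = Pr (enc_list as) (enc_list (map q ps))"
    and "\<forall>p\<in>set ps. ora (q p) = Pr (enc_list (A p)) (enc_list (B p))"
  shows "\<exists>s n. exec ora (kernelization_com (P 0)) (init d) s n (q ` set ps) \<and>
    s 0 = Pr (enc_list (rev (concat (map A ps)) @ as)) (enc_list (rev (concat (map B ps)))) \<and>
    n \<le> T d + (\<Sum>p\<leftarrow>ps. 3 * (length (A p) + length (B p)) + 7) + 5"
proof -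
  obtain s1 n1 where 1: "exec ora (P 0) (init d) s1 n1 {}" "s1 0 = f d" "n1 \<le> T d"
    using implementsE[OF assms(1), of ora 0 "init d"] by (auto simp: init_def)
  let ?s2 = "s1(1 := enc_list as)"
  let ?s3 = "?s2(2 := enc_list (map q ps))"
  let ?s4 = "?s3(3 := Nl)"
  obtain s5 n5 where 5: "exec ora ask_com ?s4 s5 n5 (q ` set ps)"
    "s5 1 = enc_list (rev (concat (map A ps)) @ as)" "s5 3 = enc_list (rev (concat (map B ps)))"
    "n5 \<le> 1 + (\<Sum>p\<leftarrow>ps. 3 * (length (A p) + length (B p)) + 7)"
    using exec_ask_com[of ps ora q A B ?s4 as "[]", OF assms(3)] by auto
  let ?s6 = "s5(0 := Pr (s5 1) (s5 3))"
  have "exec ora (kernelization_com (P 0)) (init d) ?s6 (n1 + (1 + (1 + (1 + (n5 + 1)))))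
      ({} \<union> ({} \<union> ({} \<union> ({} \<union> (q ` set ps \<union> {})))))"
    unfolding kernelization_com_def
    by (rule exec.Seq[OF 1(1) exec.Seq[OF exec_Assign exec.Seq[OF exec_Assign
            exec.Seq[OF exec_Assign exec.Seq[OF 5(1) exec_Assign]]]]])
      (simp_all add: 1 f)
  then show ?thesis using 1 5
    by (intro exI[of _ ?s6] exI[of _ "n1 + (1 + (1 + (1 + (n5 + 1))))"]) simp
qed

section \<open>The kernelization\<close>

lemma distinct_concat_map_subset:
  assumes "distinct (concat qs)" "\<And>q. q \<in> set qs \<Longrightarrow> distinct (g q) \<and> set (g q) \<subseteq> set q"
  shows "distinct (concat (map g qs))"
  using assms
proof (induction qs)
  case (Cons q qs)
  have "set (concat (map g qs)) \<subseteq> set (concat qs)" using Cons.prems(2) by auto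
  moreover have "set (g q) \<subseteq> set q" using Cons.prems(2) by simp
  moreover have "set q \<inter> set (concat qs) = {}" using Cons.prems(1) by simp
  ultimately have "set (g q) \<inter> set (concat (map g qs)) = {}" by blast
  moreover have "distinct (concat (map g qs))" "distinct (g q)" using Cons by simp_all
  ultimately show ?case by simp
qed simp

text \<open>The oracle returns a separate function for every piece; disjointness glues them into
  one. The equation on the lengths bounds the time for reading all answers by |V|.\<close>

lemma combine_answers:
  assumes G: "simple_graph G" and dist: "distinct (concat qs)" and verts: "set (concat qs) = verts G"
    and ans: "\<forall>q\<in>set qs. approx_answer c (cinduced G (set q)) (a q)"
  obtains X f A B where "cap_dom_set G X f"
    "real (card X) \<le> c * real (\<Sum>q\<leftarrow>qs. cds_opt (cinduced G (set q)))"
    "\<forall>q\<in>set qs. a q = Pr (enc_list (A q)) (enc_list (B q)) \<and> length (A q) + length (B q) = card (set q)"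
    "encodes_solution (Pr (enc_list (rev (concat (map A qs)))) (enc_list (rev (concat (map B qs))))) G X f"
proof -
  from ans obtain X F where XF: "\<forall>q\<in>set qs. encodes_solution (a q) (cinduced G (set q)) (X q) (F q) \<and>
      approx_cds c (cinduced G (set q)) (X q) (F q)"
    unfolding approx_answer_def by metis
  then obtain xs ys where xy: "\<forall>q\<in>set qs. distinct (xs q) \<and> set (xs q) = X q \<and> distinct (ys q) \<and>
      set (ys q) = verts (cinduced G (set q)) - X q \<and>
      a q = Pr (enc_list (map enc_nat (xs q))) (enc_list (map (\<lambda>v. enc_nat_pair (v, F q v)) (ys q)))"
    unfolding encodes_solution_def by metis
  define f where "f v = F (THE q. q \<in> set qs \<and> v \<in> set q) v" for v
  have f: "f v = F q v" if "q \<in> set qs" "v \<in> set q" for q v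
  proof -
    have "(THE q. q \<in> set qs \<and> v \<in> set q) = q"
      using that distinct_concat_unique[OF dist] by (intro the_equality) auto
    then show ?thesis by (simp add: f_def)
  qed
  have sub: "verts G \<inter> set q = set q" if "q \<in> set qs" for q using verts that by auto
  have Xsub: "X q \<subseteq> set q" if "q \<in> set qs" for q
    using XF that by (auto simp: approx_cds_def cap_dom_set_def)
  have dom: "cap_dom_set (cinduced G (set q)) (X q) f" if "q \<in> set qs" for q
  proof -
    have "cap_dom_set (cinduced G (set q)) (X q) (F q)" using XF that by (simp add: approx_cds_def)
    moreover have "{v \<in> set q - X q. F q v = x} = {v \<in> set q - X q. f v = x}" for x
      using f[OF that] by auto
    ultimately show ?thesis
      using f[OF that] unfolding cap_dom_set_def cinduced_simps sub[OF that] by auto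
  qed
  let ?X = "\<Union>q\<in>set qs. X q"
  let ?xs = "rev (concat (map xs qs))" and ?ys = "rev (concat (map ys qs))"
  let ?A = "\<lambda>q. map enc_nat (xs q)" and ?B = "\<lambda>q. map (\<lambda>v. enc_nat_pair (v, f v)) (ys q)"
  have dxs: "distinct ?xs"
    unfolding distinct_rev by (rule distinct_concat_map_subset[OF dist]) (use xy Xsub in auto)
  have dys: "distinct ?ys"
    unfolding distinct_rev by (rule distinct_concat_map_subset[OF dist]) (use xy in auto)
  have "set ?ys = verts G - ?X"
  proof -
    have "set ?ys = (\<Union>q\<in>set qs. set q - X q)" using xy sub by simp
    also have "\<dots> = (\<Union>q\<in>set qs. set q) - ?X"
      using Xsub distinct_concat_unique[OF dist] by blast
    finally show ?thesis using verts by simp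
  qed
  moreover have "set ?xs = ?X" using xy by simp
  moreover have "rev (concat (map ?A qs)) = map enc_nat ?xs"
    by (simp only: rev_map[symmetric] map_concat map_map o_def)
  moreover have "rev (concat (map ?B qs)) = map (\<lambda>v. enc_nat_pair (v, f v)) ?ys"
    by (simp only: rev_map[symmetric] map_concat map_map o_def)
  ultimately have "encodes_solution (Pr (enc_list (rev (concat (map ?A qs))))
      (enc_list (rev (concat (map ?B qs))))) G ?X f"
    unfolding encodes_solution_def using dxs dys by metis
  moreover have "real (card ?X) \<le> c * real (\<Sum>q\<leftarrow>qs. cds_opt (cinduced G (set q)))"
  proof -
    have "card ?X = card (set ?xs)" using xy by simp
    also have "\<dots> \<le> length ?xs" by (rule card_length)
    also have "\<dots> = (\<Sum>q\<leftarrow>qs. length (xs q))" by (simp add: length_concat o_def)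
    finally have "real (card ?X) \<le> real (\<Sum>q\<leftarrow>qs. length (xs q))"
      by (simp only: of_nat_le_iff)
    also have "\<dots> = (\<Sum>q\<leftarrow>qs. real (length (xs q)))"
      by (induction qs) simp_all
    also have "\<dots> \<le> (\<Sum>q\<leftarrow>qs. c * real (cds_opt (cinduced G (set q))))"
    proof (rule sum_list_mono)
      fix q assume "q \<in> set qs"
      then show "real (length (xs q)) \<le> c * real (cds_opt (cinduced G (set q)))"
        using xy XF distinct_card[of "xs q"] by (auto simp: approx_cds_def)
    qed
    also have "\<dots> = c * real (\<Sum>q\<leftarrow>qs. cds_opt (cinduced G (set q)))"
      by (induction qs) (simp_all add: algebra_simps)
    finally show ?thesis .
  qed
  moreover have "\<forall>q\<in>set qs. a q = Pr (enc_list (?A q)) (enc_list (?B q)) \<and>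
      length (?A q) + length (?B q) = card (set q)"
  proof
    fix q assume q: "q \<in> set qs"
    have "map (\<lambda>v. enc_nat_pair (v, F q v)) (ys q) = ?B q"
      using f[OF q] xy q by auto
    moreover have "length (xs q) + length (ys q) = card (X q) + card (set q - X q)"
      using xy q sub[OF q] distinct_card[of "xs q"] distinct_card[of "ys q"] by auto
    moreover have "card (X q) + card (set q - X q) = card (set q)"
      using Xsub[OF q] card_Diff_subset[of "X q" "set q"] card_mono[of "set q" "X q"]
      by (simp add: finite_subset)
    moreover have "a q = Pr (enc_list (?A q)) (enc_list (map (\<lambda>v. enc_nat_pair (v, F q v)) (ys q)))"
      using xy q by blast
    ultimately show "a q = Pr (enc_list (?A q)) (enc_list (?B q)) \<and>
      length (?A q) + length (?B q) = card (set q)" by (simp only: length_map)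
  qed
  moreover have "cap_dom_set G ?X f" by (rule cap_dom_set_Union[OF G dist verts dom])
  ultimately show thesis using that[of ?X f ?A ?B] by blast
qed

section \<open>Bag sizes and positivity of width and degree\<close>

lemma card_bag_le:
  assumes "tree_decomposition G (graph_of T) (bag_at T)" "is_pos T p"
  shows "card (bag_at T p) \<le> rwidth T + 1"
proof -
  have "finite (verts (graph_of T))"
    using assms(1) by (simp add: tree_decomposition_def tree_graph_def simple_graph_def)
  moreover have "p \<in> verts (graph_of T)" using assms(2) by (simp add: graph_of_def)
  ultimately have "card (bag_at T p) \<le> Max ((\<lambda>t. card (bag_at T t)) ` verts (graph_of T))"
    by (intro Max_ge) auto
  then show ?thesis by (simp add: rwidth_def width_def)
qed

text \<open>Together with \<open>max_degree_pos\<close> this absorbs the additive ones: tw + 1 \<le>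
  2 tw and \<Delta> + 1 \<le> 2 \<Delta>, as required by a bound that is a pure product.\<close>

lemma rwidth_pos:
  assumes td: "tree_decomposition G (graph_of T) (bag_at T)" and "simple_graph G" "e \<in> edges G"
  shows "1 \<le> rwidth T"
proof -
  obtain p where p: "is_pos T p" "e \<subseteq> bag_at T p"
    using td assms(3) by (auto simp: tree_decomposition_def graph_of_def)
  have "bag_at T p \<subseteq> verts G" using td p(1) by (auto simp: tree_decomposition_def graph_of_def)
  then have "finite (bag_at T p)" using assms(2) finite_subset by (auto simp: simple_graph_def)
  then have "card e \<le> card (bag_at T p)" using p by (intro card_mono)
  moreover have "card e = 2" using assms(2,3) by (simp add: simple_graph_def)
  ultimately show ?thesis using card_bag_le[OF td p(1)] by linarith
qed

lemma max_degree_pos: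
  assumes "simple_graph G" "e \<in> edges G" shows "1 \<le> max_degree G"
proof -
  obtain a b where ab: "e = {a, b}" using assms by (auto simp: simple_graph_def card_2_iff dest!: bspec)
  then have "{u. {a, u} \<in> edges G} \<noteq> {}" using assms(2) by auto
  then have "1 \<le> card {u. {a, u} \<in> edges G}"
    using finite_neighbours[OF assms(1), of a] by (simp add: Suc_le_eq card_gt_0_iff)
  then show ?thesis using degree_le_max_degree[OF assms(1), of a] by linarith
qed

lemma length_le_size_enc_list: "length xs \<le> size (enc_list xs)"
  by (induction xs) auto

theorem theorem10:
  shows "\<exists>C > 0. \<forall>\<epsilon> > 0.
    approx_turing_kernelization (1 + \<epsilon>)
      (\<lambda>G. treewidth G + max_degree G)
      (\<lambda>G. C * ((1 + \<epsilon>) / \<epsilon>) * real (treewidth G) * real (max_degree G) ^ 2)"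
\<comment> \<open>With w \<le> 2 tw and u \<le> 4 k \<Delta>^2, a piece has at most w + 2 w u \<le>
  2 tw + 16 k tw \<Delta>^2 \<le> 18 k tw \<Delta>^2 vertices.\<close>
proof (intro exI[of _ "18 :: real"] conjI allI impI)
  fix \<epsilon> :: real assume \<epsilon>: "\<epsilon> > 0"
  define b where "b G = 18 * ((1 + \<epsilon>) / \<epsilon>) * real (treewidth G) * real (max_degree G) ^ 2" for G :: "nat cgraph"
  define k where "k = nat \<lceil>1 / \<epsilon>\<rceil>"
  \<comment> \<open>The lower bound on \<open>k\<close> gives the ratio (k + 1) / k \<le> 1 +
    \<epsilon>, the upper one the factor in the query size.\<close>
  have k: "1 / \<epsilon> \<le> real k" "real k \<le> (1 + \<epsilon>) / \<epsilon>" "0 < real k"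
  proof -
    have "0 < 1 / \<epsilon>" using \<epsilon> by simp
    moreover show "1 / \<epsilon> \<le> real k" unfolding k_def by linarith
    ultimately show "0 < real k" by linarith
    have "real k \<le> 1 / \<epsilon> + 1" using \<open>0 < 1 / \<epsilon>\<close> unfolding k_def by linarith
    also have "\<dots> = (1 + \<epsilon>) / \<epsilon>" using \<epsilon> by (simp add: field_simps)
    finally show "real k \<le> (1 + \<epsilon>) / \<epsilon>" .
  qed
  have bounded: "\<exists>h :: nat \<Rightarrow> nat. \<forall>G. simple_graph G \<longrightarrow> b G \<le> real (h (treewidth G + max_degree G))"
  proof (intro exI allI impI)
    fix G :: "nat cgraph"
    let ?m = "treewidth G + max_degree G"
    have "real (treewidth G) * real (max_degree G) ^ 2 \<le> real ?m * real ?m ^ 2"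
      by (intro mult_mono power_mono) auto
    then have "(18 * ((1 + \<epsilon>) / \<epsilon>)) * (real (treewidth G) * real (max_degree G) ^ 2) \<le>
        (18 * ((1 + \<epsilon>) / \<epsilon>)) * (real ?m * real ?m ^ 2)"
      using \<epsilon> by (intro mult_left_mono) auto
    then show "b G \<le> real ((\<lambda>m. nat \<lceil>18 * ((1 + \<epsilon>) / \<epsilon>) * (real m * real m ^ 2)\<rceil>) ?m)"
      unfolding b_def mult.assoc by linarith
  qed
  define ks where "ks = replicate k Nl"
  obtain P T where P: "implements P (dplan (enc_list ks)) T" "pbounded T"
    using ptimeE[OF ptime_dplan] .
  obtain e where e: "\<And>d. T d \<le> (size d + 2) ^ e" using P(2) unfolding pbounded_def by blast
  \<comment> \<open>The power pays for computing the plan, 10 per vertex for asking and reading the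
    answers, and 5 for the four remaining assignments and the last loop test.\<close>
  define p where "p = [:2, 1:] ^ e + [:5, 10 :: nat:]"
  have p: "poly p n = (n + 2) ^ e + (10 * n + 5)" for n
    by (simp add: p_def poly_power add.commute mult.commute)
  have "\<exists>s n Q. exec ora (kernelization_com (P 0)) (init (Pr dG dT)) s n Q \<and>
      n \<le> poly p (size (Pr dG dT)) \<and>
      (\<forall>q\<in>Q. \<exists>H. simple_graph H \<and> real (card (verts H)) \<le> b G \<and> encodes_cgraph q H) \<and>
      approx_answer (c * (1 + \<epsilon>)) G (s 0)"
    if G: "simple_graph G" and nice: "nice_tree_decomposition G tr" and tw: "rwidth tr = treewidth G"
      and dG: "encodes_cgraph dG G" and dT: "encodes_rtree dT tr" and c: "c \<ge> 1"
      and ora: "approx_oracle c (b G) ora" for G tr dG dT c ora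
  proof -
    obtain vs es where vs: "distinct vs" "set vs = verts G"
      and es: "distinct (map (\<lambda>(u, v). {u, v}) es)" "set (map (\<lambda>(u, v). {u, v}) es) = edges G"
      and dG_eq: "dG = Pr (enc_list (map (\<lambda>v. enc_nat_pair (v, cap G v)) vs)) (enc_list (map enc_nat_pair es))"
      using dG unfolding encodes_cgraph_def by blast
    obtain t where t: "map_rtree set t = tr" "\<forall>b\<in>set_rtree t. distinct b" "dT = enc_rtree t"
      using dT unfolding encodes_rtree_def by blast
    have td: "tree_decomposition G (graph_of tr) (bag_at tr)"
      using nice by (simp add: nice_tree_decomposition_def)
    let ?d = "Pr dG dT" and ?\<Delta> = "max_degree G"
    have T: "T ?d \<le> (size ?d + 2) ^ e" by (rule e)
    show ?thesis
    proof (cases "es = []")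
      case True
      have plan: "dplan (enc_list ks) ?d = Pr (enc_list (rev (map enc_nat vs))) (enc_list (map id []))"
        using True by (simp add: dplan_def dG_eq o_def)
      obtain s n where s: "exec ora (kernelization_com (P 0)) (init ?d) s n {}"
        "s 0 = Pr (enc_list (map enc_nat (rev vs))) Nl" "n \<le> T ?d + 5"
        using exec_kernelization_com[OF P(1) plan, of ora "\<lambda>_. []" "\<lambda>_. []"] by (auto simp: rev_map)
      have "encodes_solution (s 0) G (verts G) id"
        unfolding encodes_solution_def s(2) using vs by (intro exI[of _ "rev vs"] exI[of _ "[]"]) simp
      \<comment> \<open>With \<Delta> = 0 the lower bound on solutions becomes |V| itself, so the
        full vertex set is optimal.\<close>
      moreover have "real (card (verts G)) \<le> c * (1 + \<epsilon>) * real (cds_opt G)"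
      proof -
        obtain X f where X: "cap_dom_set G X f" "card X = cds_opt G" by (rule cds_opt_attained)
        have "edges G = {}" using es(2) True by simp
        then have "?\<Delta> = 0" by (auto simp: max_degree_def degree_of_def image_constant_conv)
        then have "real (card (verts G)) \<le> 1 * real (cds_opt G)"
          using card_verts_le[OF G X(1)] X(2) by simp
        also have "\<dots> \<le> c * (1 + \<epsilon>) * real (cds_opt G)"
          using mult_mono[of 1 c 1 "1 + \<epsilon>"] c \<epsilon> by (intro mult_right_mono) auto
        finally show ?thesis .
      qed
      ultimately have "approx_answer (c * (1 + \<epsilon>)) G (s 0)"
        unfolding approx_answer_def approx_cds_def using cap_dom_set_verts by blast
      moreover have "n \<le> poly p (size ?d)" using s(3) T unfolding p by linarith
      ultimately show ?thesis using s(1) by blast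
    next
      case False
      then obtain edge where edge: "edge \<in> edges G" using es(2) by (cases es) auto
      define w where "w = rwidth tr + 1"
      define u where "u = k * (?\<Delta> + 1) ^ 2"
      obtain r ps where ps: "pieces u [] [t] [] = (r, ps)" by fastforce
      let ?N = "\<lambda>v. {w. {v, w} \<in> edges G}"
      have dec: "decomposes ?N [] [t]" "tree_verts t = verts G"
        using tree_decomposition_decomposes[of G t] td t by auto
      have "\<forall>b\<in>set_rtree t. length b \<le> w"
      proof
        fix b assume "b \<in> set_rtree t"
        then obtain x where x: "is_pos t x" "label (subtree t x) = b" "distinct b"
          using t(2) by (auto simp: set_rtree_iff)
        then have "bag_at tr x = set b"
          using t(1) label_subtree_map_rtree[of t x set] by (simp add: bag_at_def)
        then show "length b \<le> w"
          using card_bag_le[OF td, of x] x t(1) distinct_card[of b] by (auto simp: w_def)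
      qed
      \<comment> \<open>The virtual parent bag is empty, so the remainder has length at most
        0.\<close>
      then have len: "r = []" "\<forall>(b, p)\<in>set ps. length b * u < length p \<and> length p \<le> w + 2 * (w * u)"
        using pieces_length[OF ps, of w] by auto
      have part: "piece_verts ps = verts G" "distinct (concat (map snd ps))"
        using pieces_partition[OF dec(1) ps] dec(2) len(1) by auto
      have sep: "separated ?N {} ps" using pieces_separated[OF dec(1) ps, of "{}"] by auto
      let ?qs = "map snd ps"
      have qs: "distinct (concat ?qs)" "set (concat ?qs) = verts G"
        using part by (simp_all only: set_concat_pieces)
      have "card (set q) \<le> w + 2 * (w * u)" if "q \<in> set ?qs" for q
        using len(2) that card_length[of q] by fastforce
      moreover have "real (w + 2 * (w * u)) \<le> b G"
      proof -
        have tw1: "1 \<le> treewidth G" using rwidth_pos[OF td G edge] tw by simp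
        have D1: "1 \<le> ?\<Delta>" using max_degree_pos[OF G edge] .
        have "1 \<le> k" using k(3) by simp
        have "w \<le> 2 * treewidth G" using tw tw1 by (simp add: w_def)
        moreover have "u \<le> k * (2 * ?\<Delta>) ^ 2"
          unfolding u_def using D1 by (intro mult_le_mono2 power_mono) auto
        ultimately have "w * u \<le> (2 * treewidth G) * (k * (2 * ?\<Delta>) ^ 2)" by (rule mult_le_mono)
        then have "w * u \<le> 8 * (k * treewidth G * ?\<Delta> ^ 2)" by (simp add: power2_eq_square algebra_simps)
        moreover have "treewidth G \<le> k * treewidth G * ?\<Delta> ^ 2" using \<open>1 \<le> k\<close> D1 by simp
        ultimately have "w + 2 * (w * u) \<le> 18 * (k * treewidth G * ?\<Delta> ^ 2)"
          using \<open>w \<le> 2 * treewidth G\<close> by linarith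
        then have "real (w + 2 * (w * u)) \<le> real (18 * (k * treewidth G * ?\<Delta> ^ 2))"
          by (simp only: of_nat_le_iff)
        also have "\<dots> = real k * (18 * real (treewidth G) * real ?\<Delta> ^ 2)" by simp
        also have "\<dots> \<le> (1 + \<epsilon>) / \<epsilon> * (18 * real (treewidth G) * real ?\<Delta> ^ 2)"
          using k(2) by (intro mult_right_mono) auto
        also have "\<dots> = b G" unfolding b_def by (simp only: mult_ac)
        finally show ?thesis .
      qed
      ultimately have small: "real (card (set q)) \<le> b G" if "q \<in> set ?qs" for q
        using that by (meson of_nat_le_iff order_trans)
      define query where "query q = dinduced dG (enc_list (map enc_nat q))" for q
      have query: "encodes_cgraph (query q) (cinduced G (set q))" for q
        unfolding query_def dG_eq by (rule dinduced_encodes[OF vs es])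
      have card_H: "real (card (verts (cinduced G (set q)))) \<le> b G" if "q \<in> set ?qs" for q
      proof -
        have "card (verts (cinduced G (set q))) \<le> card (set q)" by (intro card_mono) auto
        then show ?thesis using small[OF that] by linarith
      qed
      have "\<forall>q\<in>set ?qs. approx_answer c (cinduced G (set q)) (ora (query q))"
        using ora query card_H simple_graph_cinduced[OF G] unfolding approx_oracle_def by blast
      from combine_answers[OF G qs this] obtain X f A B where ans:
        "cap_dom_set G X f" "real (card X) \<le> c * real (\<Sum>q\<leftarrow>?qs. cds_opt (cinduced G (set q)))"
        "\<forall>q\<in>set ?qs. ora (query q) = Pr (enc_list (A q)) (enc_list (B q)) \<and>
           length (A q) + length (B q) = card (set q)"
        "encodes_solution (Pr (enc_list (rev (concat (map A ?qs)))) (enc_list (rev (concat (map B ?qs))))) G X f"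
        by blast
      obtain us where us: "dunit (enc_list ks) dG = enc_list us" "length us = u"
      proof -
        have "(\<lambda>v. length (incident v es)) ` set vs = degree_of G ` verts G"
          using length_incident[OF G es] vs(2) by simp
        then show thesis
          using that dunit_enc[of ks "cap G" vs es] unfolding dG_eq
          by (auto simp: ks_def u_def max_degree_def)
      qed
      have "dpieces (enc_list us) dT = enc_list (rev (map (\<lambda>p. enc_list (map enc_nat (snd p))) ps))"
        using dpieces_enc[of us t r ps] ps us(2) t(3) by simp
      moreover have "right dG \<noteq> Nl" using False by (cases es) (simp_all add: dG_eq)
      ultimately have plan: "dplan (enc_list ks) ?d = Pr (enc_list []) (enc_list (map query ?qs))"
        by (simp add: dplan_def us(1) query_def[abs_def] o_def rev_map)
      obtain s n where s: "exec ora (kernelization_com (P 0)) (init ?d) s n (query ` set ?qs)"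
        "s 0 = Pr (enc_list (rev (concat (map A ?qs)))) (enc_list (rev (concat (map B ?qs))))"
        "n \<le> T ?d + (\<Sum>q\<leftarrow>?qs. 3 * (length (A q) + length (B q)) + 7) + 5"
        using exec_kernelization_com[of P "dplan (enc_list ks)" T ?d "[]" query ?qs ora A B,
            OF P(1) plan] ans(3) by auto
      \<comment> \<open>Pieces exceed their cut-off, so they are nonempty and the constant 7 per
        query can be charged to their vertices.\<close>
      have "(\<Sum>q\<leftarrow>?qs. 3 * (length (A q) + length (B q)) + 7) \<le> (\<Sum>q\<leftarrow>?qs. 10 * length q)"
      proof (rule sum_list_mono)
        fix q assume q: "q \<in> set ?qs"
        then have "1 \<le> length q" using len(2) by fastforce
        moreover have "length (A q) + length (B q) \<le> length q" using bspec[OF ans(3) q] card_length[of q] by simp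
        moreover have "3 * x + 7 \<le> 10 * y" if "1 \<le> y" "x \<le> y" for x y :: nat
          using that by linarith
        ultimately show "3 * (length (A q) + length (B q)) + 7 \<le> 10 * length q" by blast
      qed
      also have "\<dots> = 10 * length (concat ?qs)" by (simp add: length_concat sum_list_const_mult o_def)
      also have "length (concat ?qs) = length vs"
        using distinct_card[OF qs(1)] distinct_card[OF vs(1)] unfolding qs(2) vs(2) by linarith
      also have "length vs \<le> size ?d"
        using length_le_size_enc_list[of "map (\<lambda>v. enc_nat_pair (v, cap G v)) vs"] by (simp add: dG_eq)
      finally have "n \<le> poly p (size ?d)" using s(3) T unfolding p by linarith
      moreover have "\<forall>q\<in>query ` set ?qs.
          \<exists>H. simple_graph H \<and> real (card (verts H)) \<le> b G \<and> encodes_cgraph q H"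
        using query card_H simple_graph_cinduced[OF G] by blast
      moreover have "real (card X) \<le> c * (1 + \<epsilon>) * real (cds_opt G)"
      proof -
        let ?s = "\<Sum>q\<leftarrow>?qs. cds_opt (cinduced G (set q))"
        have "k * ?s \<le> (k + 1) * cds_opt G"
          by (rule sum_cds_opt_separated_le[OF G sep part(2,1)])
            (use len(2) in \<open>auto simp: u_def less_imp_le\<close>)
        then have "real (k * ?s) \<le> real ((k + 1) * cds_opt G)" by (simp only: of_nat_le_iff)
        then have "real k * real ?s \<le> (real k + 1) * real (cds_opt G)"
          by (simp only: of_nat_mult of_nat_add of_nat_1)
        also have "\<dots> \<le> (real k + \<epsilon> * real k) * real (cds_opt G)"
          using k(1) \<epsilon> by (intro mult_right_mono) (auto simp: field_simps)
        also have "\<dots> = real k * ((1 + \<epsilon>) * real (cds_opt G))" by (simp add: algebra_simps)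
        finally have "real ?s \<le> (1 + \<epsilon>) * real (cds_opt G)" using k(3) by (rule mult_left_le_imp_le)
        then have "c * real ?s \<le> c * ((1 + \<epsilon>) * real (cds_opt G))"
          using c by (intro mult_left_mono) auto
        then show ?thesis using ans(2) by (simp only: mult.assoc)
      qed
      then have "approx_answer (c * (1 + \<epsilon>)) G (s 0)"
        unfolding approx_answer_def approx_cds_def s(2) using ans(1,4) by blast
      ultimately show ?thesis using s(1) by blast
    qed
  qed
  then show "approx_turing_kernelization (1 + \<epsilon>) (\<lambda>G. treewidth G + max_degree G)
      (\<lambda>G. 18 * ((1 + \<epsilon>) / \<epsilon>) * real (treewidth G) * real (max_degree G) ^ 2)"
    using bounded unfolding approx_turing_kernelization_def b_def by blast
qed simp

end
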